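(* $\mathsf{WA}\subseteq\mathsf{CT}^{\mathsf{sobl}}_{\forall\forall}$ and $\mathsf{SD}\subseteq\mathsf{CT}^{\mathsf{sobl}}_{\forall\forall}$. Furthermore, for any $\Sigma\in\mathsf{SD}$ and any instance $I$, the semi-oblivious chase with $\Sigma$ on $I$ terminates in time polynomial in the size of $I$.
   Context: Let $\mathsf{Cons}$ (constants), $\mathsf{Nulls}$ (nulls) and $\mathsf{Vars}$ (variables) be pairwise disjoint countably infinite sets. An instance is a finite set of atoms $R(a_1,\dots,a_k)$ with $a_i\in\mathsf{Cons}\cup\mathsf{Nulls}$. A tgd $\xi=\alpha\to\beta$ is a sentence $\forall\bar x,\bar y\,(\alpha(\bar x,\bar y)\to\exists\bar z\,\beta(\bar x,\bar z))$, with body $\alpha$ and head $\beta$ conjunctions of relational atoms over variables and constants; $\bar x$ are the universal variables occurring in both body and head. Sets of tgds are finite. A trigger for $\Sigma$ on $I$ is a pair $(\xi,h)$ with $\xi=\alpha\to\beta\in\Sigma$ and $h$ a mapping of the universal variables of $\xi$ to $\mathsf{Cons}\cup\mathsf{Nulls}$ (identity on constants) with $h(\alpha)\subseteq I$. Firing it transforms $I$ into $I\cup h'(\beta)$, where $h'$ extends $h$ by assigning new fresh nulls to the existential variables. Triggers $(\xi,h)$ and $(\xi,g)$ are equivalent if $h(\bar x)=g(\bar x)$. A semi-oblivious chase sequence with $\Sigma$ on $I$ is a sequence $I=I_0,I_1,\dots$ where each $I_{i+1}$ results from $I_i$ by firing a nondeterministically chosen trigger on $I_i$ whose equivalence class contains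 no trigger already fired in the sequence (so exactly one trigger from each class is fired); it terminates if some $I_i$ has no such trigger left. Sequences are assumed fair: in an infinite sequence, for every trigger applicable at some step, a trigger of its equivalence class is eventually fired. $\mathsf{CT}^{\mathsf{sobl}}_{\forall\forall}$ is the class of sets $\Sigma$ of tgds such that for every instance $I$ all semi-oblivious chase sequences with $\Sigma$ on $I$ terminate. A position is a pair $(R,i)$ with $1\le i\le$ arity of $R$. Weak acyclicity ($\mathsf{WA}$): the dependency graph of $\Sigma$ has the positions as vertices. For each tgd in $\Sigma$, each universal variable $x$ occurring in both body and head, and each position $p$ at which $x$ occurs in the body, there is a copy edge from $p$ to every position at which $x$ occurs in the head, and a generating edge from $p$ to every position at which an existential variable occurs in the head. $\Sigma\in\mathsf{WA}$ if its dependency graph has no cycle involving a generating edge. Safe dependencies ($\mathsf{SD}$, Meier, Schmidt and Lausen): the set of affected positions of $\Sigma$ is the least set such that (a) every position at which an existential variable occurs in the head of some tgd of $\Sigma$ is affected, and (b) if a universal variable $x$ of a tgd in $\Sigma$ occurs in its body only in affected positions, then every position at which $x$ occurs in its head is affected. The propagation graph of $\Sigma$ has the affected positions as vertices; for each tgd in $\Sigma$, each universal variable $x$ that occurs in both body and head and occurs in the body only in affected positions, and each position $p$ at which $x$ occurs in the body, there is a normal edge from $p$ to every position at which $x$ occurs in the head, and a special edge from $p$ to every position at which an existential variable occurs in the head. $\Sigma\in\mathsf{SD}$ if its propagation graph has no cycle through a special edge. *)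

theory Defs
  imports Complex_Main "HOL-Library.Extended_Nat" "HOL-Computational_Algebra.Polynomial"
begin

section \<open>Instances and tuple-generating dependencies\<close>

datatype "value" = Const nat | Null nat

datatype tm = Var nat | Cst nat

datatype (dead 'r, 't) atom = Atom (rel: 'r) (args: "'t list")

type_synonym 'r fact = "('r, value) atom"

text \<open>The schema is given by an arity function on the relation symbols.\<close>

definition wf_atom :: "('r \<Rightarrow> nat) \<Rightarrow> ('r, 't) atom \<Rightarrow> bool" where
  "wf_atom ar a \<longleftrightarrow> length (args a) = ar (rel a)"

definition is_instance :: "('r \<Rightarrow> nat) \<Rightarrow> 'r fact set \<Rightarrow> bool" where
  "is_instance ar I \<longleftrightarrow> finite I \<and> (\<forall>a\<in>I. wf_atom ar a)"

definition dom_inst :: "'r fact set \<Rightarrow> value set" where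
  "dom_inst I = (\<Union>a\<in>I. set (args a))"

definition inst_size :: "'r fact set \<Rightarrow> nat" where
  "inst_size I = (\<Sum>a\<in>I. 1 + length (args a))"

text \<open>
  Quantifiers are implicit: the variables of the body are universal, those occurring only in
  the head are existential.
\<close>

datatype 'r tgd = TGD (body: "('r, tm) atom list") (head: "('r, tm) atom list")

definition vars :: "('r, tm) atom list \<Rightarrow> nat set" where
  "vars As = {x. \<exists>a\<in>set As. Var x \<in> set (args a)}"

definition uvars :: "'r tgd \<Rightarrow> nat set" where
  "uvars \<xi> = vars (body \<xi>)"

definition evars :: "'r tgd \<Rightarrow> nat set" where
  "evars \<xi> = vars (head \<xi>) - vars (body \<xi>)"

definition frontier :: "'r tgd \<Rightarrow> nat set" where
  "frontier \<xi> = vars (body \<xi>) \<inter> vars (head \<xi>)"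

definition tgd_set :: "('r \<Rightarrow> nat) \<Rightarrow> 'r tgd set \<Rightarrow> bool" where
  "tgd_set ar \<Sigma> \<longleftrightarrow>
     finite \<Sigma> \<and> (\<forall>\<xi>\<in>\<Sigma>. \<forall>a\<in>set (body \<xi>) \<union> set (head \<xi>). wf_atom ar a)"

section \<open>The semi-oblivious chase\<close>

primrec subst_tm :: "(nat \<Rightarrow> value) \<Rightarrow> tm \<Rightarrow> value" where
  "subst_tm h (Var x) = h x"
| "subst_tm h (Cst c) = Const c"

definition subst :: "(nat \<Rightarrow> value) \<Rightarrow> ('r, tm) atom list \<Rightarrow> 'r fact set" where
  "subst h As = map_atom (subst_tm h) ` set As"

text \<open>
  The mapping of a trigger is a total function, but only its values on the universal
  variables of the tgd are ever used.
\<close>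

type_synonym 'r trigger = "'r tgd \<times> (nat \<Rightarrow> value)"

definition is_trigger :: "'r tgd set \<Rightarrow> 'r fact set \<Rightarrow> 'r trigger \<Rightarrow> bool" where
  "is_trigger \<Sigma> I t \<longleftrightarrow> fst t \<in> \<Sigma> \<and> subst (snd t) (body (fst t)) \<subseteq> I"

definition trigger_equiv :: "'r trigger \<Rightarrow> 'r trigger \<Rightarrow> bool" where
  "trigger_equiv t u \<longleftrightarrow> fst t = fst u \<and> (\<forall>x\<in>frontier (fst t). snd t x = snd u x)"

text \<open>\<open>fires I t g J\<close>: firing \<open>t\<close> on \<open>I\<close> by means of the extension \<open>g\<close> of its mapping gives \<open>J\<close>.\<close>

definition fires :: "'r fact set \<Rightarrow> 'r trigger \<Rightarrow> (nat \<Rightarrow> value) \<Rightarrow> 'r fact set \<Rightarrow> bool" where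
  "fires I t g J \<longleftrightarrow>
     (\<forall>x\<in>uvars (fst t). g x = snd t x) \<and>
     inj_on g (evars (fst t)) \<and>
     (\<forall>z\<in>evars (fst t). g z \<in> range Null - dom_inst I) \<and>
     J = I \<union> subst g (head (fst t))"

text \<open>
  A sequence has \<open>N\<close> (possibly infinitely many) steps; step \<open>i\<close> leads from \<open>S i\<close> to
  \<open>S (Suc i)\<close> by firing the trigger \<open>T i\<close> with the extended mapping \<open>H i\<close>.  Values of \<open>S\<close>
  beyond \<open>N\<close>, and of \<open>T\<close> and \<open>H\<close> from \<open>N\<close> on, are irrelevant.
\<close>

definition active ::
    "'r tgd set \<Rightarrow> (nat \<Rightarrow> 'r fact set) \<Rightarrow> (nat \<Rightarrow> 'r trigger) \<Rightarrow> nat \<Rightarrow> 'r trigger \<Rightarrow> bool" where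
  "active \<Sigma> S T i t \<longleftrightarrow> is_trigger \<Sigma> (S i) t \<and> (\<forall>j<i. \<not> trigger_equiv (T j) t)"

definition chase_sequence ::
    "'r tgd set \<Rightarrow> 'r fact set \<Rightarrow> enat \<Rightarrow> (nat \<Rightarrow> 'r fact set) \<Rightarrow> (nat \<Rightarrow> 'r trigger) \<Rightarrow>
     (nat \<Rightarrow> nat \<Rightarrow> value) \<Rightarrow> bool" where
  "chase_sequence \<Sigma> I N S T H \<longleftrightarrow>
     S 0 = I \<and>
     (\<forall>i. enat i < N \<longrightarrow> active \<Sigma> S T i (T i) \<and> fires (S i) (T i) (H i) (S (Suc i))) \<and>
     (\<forall>n. N = enat n \<longrightarrow> \<not> (\<exists>t. active \<Sigma> S T n t)) \<and>
     (N = \<infinity> \<longrightarrow> (\<forall>i t. is_trigger \<Sigma> (S i) t \<longrightarrow> (\<exists>j. trigger_equiv (T j) t)))"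

definition terminates_at ::
    "'r tgd set \<Rightarrow> enat \<Rightarrow> (nat \<Rightarrow> 'r fact set) \<Rightarrow> (nat \<Rightarrow> 'r trigger) \<Rightarrow> nat \<Rightarrow> bool" where
  "terminates_at \<Sigma> N S T n \<longleftrightarrow> enat n \<le> N \<and> \<not> (\<exists>t. active \<Sigma> S T n t)"

definition CT_sobl :: "('r \<Rightarrow> nat) \<Rightarrow> 'r tgd set set" where
  "CT_sobl ar = {\<Sigma>. tgd_set ar \<Sigma> \<and>
     (\<forall>I. is_instance ar I \<longrightarrow>
        (\<forall>N S T H. chase_sequence \<Sigma> I N S T H \<longrightarrow> (\<exists>n. terminates_at \<Sigma> N S T n)))}"

section \<open>Weak acyclicity and safety\<close>

text \<open>Positions are counted from 1.\<close>

type_synonym 'r position = "'r \<times> nat"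

definition positions_of :: "nat \<Rightarrow> ('r, tm) atom list \<Rightarrow> 'r position set" where
  "positions_of x As =
     {(rel a, i) |a i. a \<in> set As \<and> 1 \<le> i \<and> i \<le> length (args a) \<and> args a ! (i - 1) = Var x}"

definition copy_edges :: "'r tgd set \<Rightarrow> 'r position rel" where
  "copy_edges \<Sigma> = {(p, q). \<exists>\<xi>\<in>\<Sigma>. \<exists>x\<in>frontier \<xi>.
     p \<in> positions_of x (body \<xi>) \<and> q \<in> positions_of x (head \<xi>)}"

definition generating_edges :: "'r tgd set \<Rightarrow> 'r position rel" where
  "generating_edges \<Sigma> = {(p, q). \<exists>\<xi>\<in>\<Sigma>. \<exists>x\<in>frontier \<xi>. \<exists>z\<in>evars \<xi>.
     p \<in> positions_of x (body \<xi>) \<and> q \<in> positions_of z (head \<xi>)}"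

definition cycle_through :: "'v rel \<Rightarrow> 'v rel \<Rightarrow> bool" where
  "cycle_through E F \<longleftrightarrow> (\<exists>p q. (p, q) \<in> F \<and> (q, p) \<in> (E \<union> F)\<^sup>*)"

definition WA :: "('r \<Rightarrow> nat) \<Rightarrow> 'r tgd set set" where
  "WA ar = {\<Sigma>. tgd_set ar \<Sigma> \<and> \<not> cycle_through (copy_edges \<Sigma>) (generating_edges \<Sigma>)}"

inductive_set affected :: "'r tgd set \<Rightarrow> 'r position set" for \<Sigma> :: "'r tgd set" where
  existential: "\<xi> \<in> \<Sigma> \<Longrightarrow> z \<in> evars \<xi> \<Longrightarrow> p \<in> positions_of z (head \<xi>) \<Longrightarrow> p \<in> affected \<Sigma>"
| propagate: "\<xi> \<in> \<Sigma> \<Longrightarrow> x \<in> uvars \<xi> \<Longrightarrow> (\<And>q. q \<in> positions_of x (body \<xi>) \<Longrightarrow> q \<in> affected \<Sigma>) \<Longrightarrow>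
    p \<in> positions_of x (head \<xi>) \<Longrightarrow> p \<in> affected \<Sigma>"

definition normal_edges :: "'r tgd set \<Rightarrow> 'r position rel" where
  "normal_edges \<Sigma> = {(p, q). \<exists>\<xi>\<in>\<Sigma>. \<exists>x\<in>frontier \<xi>.
     positions_of x (body \<xi>) \<subseteq> affected \<Sigma> \<and>
     p \<in> positions_of x (body \<xi>) \<and> q \<in> positions_of x (head \<xi>)}"

definition special_edges :: "'r tgd set \<Rightarrow> 'r position rel" where
  "special_edges \<Sigma> = {(p, q). \<exists>\<xi>\<in>\<Sigma>. \<exists>x\<in>frontier \<xi>. \<exists>z\<in>evars \<xi>.
     positions_of x (body \<xi>) \<subseteq> affected \<Sigma> \<and>
     p \<in> positions_of x (body \<xi>) \<and> q \<in> positions_of z (head \<xi>)}"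

definition SD :: "('r \<Rightarrow> nat) \<Rightarrow> 'r tgd set set" where
  "SD ar = {\<Sigma>. tgd_set ar \<Sigma> \<and> \<not> cycle_through (normal_edges \<Sigma>) (special_edges \<Sigma>)}"

section \<open>Running time of the chase\<close>

text \<open>
  The running time of a chase sequence is the number of elementary operations of the following
  implementation on lists.  The state consists of the list of the facts derived so far and the
  list of the classes of the fired triggers, each represented by the tgd and the values of its
  frontier variables.  In every step \<^emph>\<open>all\<close> maps of the universal variables to values
  occurring in the instance are enumerated, those that are triggers of a class not yet fired
  are collected, and one of them, chosen by the sequence, is fired.  The search that finds
  nothing is charged as well.

  A function with suffix \<open>_t\<close> returns its result together with its cost: one unit per function
  call, where comparing two values or two relation symbols or two tgds, and providing a new
  null, are elementary.  There is no early exit, so costs are worst-case costs.  The lists of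
  variables of a tgd do not depend on the instance and are not charged.
\<close>

type_synonym 'a timed = "'a \<times> nat"

primrec map_t :: "('a \<Rightarrow> 'b timed) \<Rightarrow> 'a list \<Rightarrow> 'b list timed" where
  "map_t f [] = ([], 1)"
| "map_t f (x # xs) = (let (y, c) = f x; (ys, d) = map_t f xs in (y # ys, c + d + 1))"

primrec filter_t :: "('a \<Rightarrow> bool timed) \<Rightarrow> 'a list \<Rightarrow> 'a list timed" where
  "filter_t P [] = ([], 1)"
| "filter_t P (x # xs) =
     (let (b, c) = P x; (ys, d) = filter_t P xs in (if b then x # ys else ys, c + d + 1))"

primrec all_t :: "('a \<Rightarrow> bool timed) \<Rightarrow> 'a list \<Rightarrow> bool timed" where
  "all_t P [] = (True, 1)"
| "all_t P (x # xs) = (let (b, c) = P x; (b', d) = all_t P xs in (b \<and> b', c + d + 1))"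

primrec ex_t :: "('a \<Rightarrow> bool timed) \<Rightarrow> 'a list \<Rightarrow> bool timed" where
  "ex_t P [] = (False, 1)"
| "ex_t P (x # xs) = (let (b, c) = P x; (b', d) = ex_t P xs in (b \<or> b', c + d + 1))"

primrec append_t :: "'a list \<Rightarrow> 'a list \<Rightarrow> 'a list timed" where
  "append_t [] ys = (ys, 1)"
| "append_t (x # xs) ys = (let (zs, c) = append_t xs ys in (x # zs, c + 1))"

primrec concat_map_t :: "('a \<Rightarrow> 'b list timed) \<Rightarrow> 'a list \<Rightarrow> 'b list timed" where
  "concat_map_t f [] = ([], 1)"
| "concat_map_t f (x # xs) =
     (let (ys, c) = f x; (zs, d) = concat_map_t f xs; (us, e) = append_t ys zs
      in (us, c + d + e + 1))"

fun eq_list_t :: "'a list \<Rightarrow> 'a list \<Rightarrow> bool timed" where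
  "eq_list_t [] [] = (True, 1)"
| "eq_list_t (x # xs) (y # ys) = (let (b, c) = eq_list_t xs ys in (x = y \<and> b, c + 1))"
| "eq_list_t _ _ = (False, 1)"

definition eq_atom_t :: "('r, 't) atom \<Rightarrow> ('r, 't) atom \<Rightarrow> bool timed" where
  "eq_atom_t a b = (let (e, c) = eq_list_t (args a) (args b) in (rel a = rel b \<and> e, c + 1))"

definition member_t :: "('r, 't) atom \<Rightarrow> ('r, 't) atom list \<Rightarrow> bool timed" where
  "member_t a As = ex_t (eq_atom_t a) As"

text \<open>Assignments are association lists; the value for the empty list is a dummy.\<close>

type_synonym assignment = "(nat \<times> value) list"

primrec lookup_t :: "assignment \<Rightarrow> nat \<Rightarrow> value timed" where
  "lookup_t [] x = (Const 0, 1)"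
| "lookup_t (p # \<sigma>) x =
     (if fst p = x then (snd p, 1) else (let (v, c) = lookup_t \<sigma> x in (v, c + 1)))"

primrec eval_tm_t :: "assignment \<Rightarrow> tm \<Rightarrow> value timed" where
  "eval_tm_t \<sigma> (Var x) = lookup_t \<sigma> x"
| "eval_tm_t \<sigma> (Cst c) = (Const c, 1)"

definition eval_atom_t :: "assignment \<Rightarrow> ('r, tm) atom \<Rightarrow> 'r fact timed" where
  "eval_atom_t \<sigma> a = (let (vs, c) = map_t (eval_tm_t \<sigma>) (args a) in (Atom (rel a) vs, c + 1))"

definition tm_vars :: "tm \<Rightarrow> nat list" where
  "tm_vars t = (case t of Var x \<Rightarrow> [x] | Cst _ \<Rightarrow> [])"

definition var_list :: "('r, tm) atom list \<Rightarrow> nat list" where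
  "var_list As = remdups (concat (map (\<lambda>a. concat (map tm_vars (args a))) As))"

definition frontier_list :: "'r tgd \<Rightarrow> nat list" where
  "frontier_list \<xi> = filter (\<lambda>x. x \<in> set (var_list (head \<xi>))) (var_list (body \<xi>))"

type_synonym 'r fired = "'r tgd \<times> value list"

definition body_holds_t :: "'r fact list \<Rightarrow> 'r tgd \<Rightarrow> assignment \<Rightarrow> bool timed" where
  "body_holds_t I \<xi> \<sigma> =
     all_t (\<lambda>a. let (f, c) = eval_atom_t \<sigma> a; (b, d) = member_t f I in (b, c + d + 1)) (body \<xi>)"

definition frontier_values_t :: "'r tgd \<Rightarrow> assignment \<Rightarrow> value list timed" where
  "frontier_values_t \<xi> \<sigma> = map_t (lookup_t \<sigma>) (frontier_list \<xi>)"

definition was_fired_t :: "'r fired list \<Rightarrow> 'r tgd \<Rightarrow> assignment \<Rightarrow> bool timed" where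
  "was_fired_t F \<xi> \<sigma> =
     (let (ws, c) = frontier_values_t \<xi> \<sigma>;
          (b, d) = ex_t (\<lambda>p. let (e, k) = eq_list_t (snd p) ws in (fst p = \<xi> \<and> e, k + 1)) F
      in (b, c + d + 1))"

primrec assignments_t :: "nat list \<Rightarrow> value list \<Rightarrow> assignment list timed" where
  "assignments_t [] D = ([[]], 1)"
| "assignments_t (x # xs) D =
     (let (As, c) = assignments_t xs D;
          (Bs, d) = concat_map_t (\<lambda>v. map_t (\<lambda>A. ((x, v) # A, 1)) As) D
      in (Bs, c + d + 1))"

definition search_tgd_t ::
    "'r fact list \<Rightarrow> 'r fired list \<Rightarrow> 'r tgd \<Rightarrow> ('r tgd \<times> assignment) list timed" where
  "search_tgd_t I F \<xi> =
     (let (D, c1) = concat_map_t (\<lambda>a. (args a, 1)) I;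
          (As, c2) = assignments_t (var_list (body \<xi>)) D;
          (Bs, c3) = filter_t (\<lambda>\<sigma>. let (b, c) = body_holds_t I \<xi> \<sigma>; (f, d) = was_fired_t F \<xi> \<sigma>
                                   in (b \<and> \<not> f, c + d + 1)) As;
          (Ts, c4) = map_t (\<lambda>\<sigma>. ((\<xi>, \<sigma>), 1)) Bs
      in (Ts, c1 + c2 + c3 + c4 + 1))"

definition search_t ::
    "'r tgd list \<Rightarrow> 'r fact list \<Rightarrow> 'r fired list \<Rightarrow> ('r tgd \<times> assignment) list timed" where
  "search_t \<Sigma>s I F = concat_map_t (search_tgd_t I F) \<Sigma>s"

primrec insert_all_t :: "'r fact list \<Rightarrow> 'r fact list \<Rightarrow> 'r fact list timed" where
  "insert_all_t [] I = (I, 1)"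
| "insert_all_t (a # As) I =
     (let (J, c) = insert_all_t As I; (b, d) = member_t a J
      in (if b then J else a # J, c + d + 1))"

definition fire_t ::
    "'r fact list \<Rightarrow> 'r fired list \<Rightarrow> 'r tgd \<Rightarrow> (nat \<Rightarrow> value) \<Rightarrow>
     ('r fact list \<times> 'r fired list) timed" where
  "fire_t I F \<xi> g =
     (let (\<sigma>, c1) = map_t (\<lambda>x. ((x, g x), 1)) (var_list (body \<xi> @ head \<xi>));
          (As, c2) = map_t (eval_atom_t \<sigma>) (head \<xi>);
          (J, c3) = insert_all_t As I;
          (ws, c4) = frontier_values_t \<xi> \<sigma>
      in ((J, (\<xi>, ws) # F), c1 + c2 + c3 + c4 + 1))"

text \<open>State after \<open>n\<close> steps of a sequence; the summand \<open>length Ts\<close> pays for picking a trigger.\<close>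

primrec run_t ::
    "'r tgd list \<Rightarrow> 'r fact list \<Rightarrow> (nat \<Rightarrow> 'r trigger) \<Rightarrow> (nat \<Rightarrow> nat \<Rightarrow> value) \<Rightarrow> nat \<Rightarrow>
     ('r fact list \<times> 'r fired list) timed" where
  "run_t \<Sigma>s I0 T H 0 = ((I0, []), 1)"
| "run_t \<Sigma>s I0 T H (Suc n) =
     (let ((I, F), c) = run_t \<Sigma>s I0 T H n;
          (Ts, d) = search_t \<Sigma>s I F;
          (st, e) = fire_t I F (fst (T n)) (H n)
      in (st, c + d + length Ts + e + 1))"

definition chase_time ::
    "'r tgd list \<Rightarrow> 'r fact list \<Rightarrow> (nat \<Rightarrow> 'r trigger) \<Rightarrow> (nat \<Rightarrow> nat \<Rightarrow> value) \<Rightarrow> nat \<Rightarrow> nat" where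
  "chase_time \<Sigma>s I0 T H n =
     (let ((I, F), c) = run_t \<Sigma>s I0 T H n; (_, d) = search_t \<Sigma>s I F in c + d)"

subsection \<open>Correctness of the implementation\<close>

lemma fst_map_t [simp]: "fst (map_t f xs) = map (\<lambda>x. fst (f x)) xs"
  by (induction xs) (auto simp: split_def Let_def)

lemma fst_filter_t [simp]: "fst (filter_t P xs) = filter (\<lambda>x. fst (P x)) xs"
  by (induction xs) (auto simp: split_def Let_def)

lemma fst_all_t [simp]: "fst (all_t P xs) \<longleftrightarrow> (\<forall>x\<in>set xs. fst (P x))"
  by (induction xs) (auto simp: split_def Let_def)

lemma fst_ex_t [simp]: "fst (ex_t P xs) \<longleftrightarrow> (\<exists>x\<in>set xs. fst (P x))"
  by (induction xs) (auto simp: split_def Let_def)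

lemma fst_append_t [simp]: "fst (append_t xs ys) = xs @ ys"
  by (induction xs) (auto simp: split_def Let_def)

lemma fst_concat_map_t [simp]: "fst (concat_map_t f xs) = concat (map (\<lambda>x. fst (f x)) xs)"
  by (induction xs) (auto simp: split_def Let_def)

lemma fst_eq_list_t [simp]: "fst (eq_list_t xs ys) \<longleftrightarrow> xs = ys"
  by (induction xs ys rule: eq_list_t.induct) (auto simp: split_def Let_def)

lemma fst_eq_atom_t [simp]: "fst (eq_atom_t a b) \<longleftrightarrow> a = b"
  by (auto simp: eq_atom_t_def split_def Let_def atom.expand)

lemma fst_member_t [simp]: "fst (member_t a As) \<longleftrightarrow> a \<in> set As"
  by (auto simp: member_t_def)

definition assignment_fun :: "assignment \<Rightarrow> nat \<Rightarrow> value" where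
  "assignment_fun \<sigma> x = fst (lookup_t \<sigma> x)"

lemma fst_eval_tm_t [simp]: "fst (eval_tm_t \<sigma> t) = subst_tm (assignment_fun \<sigma>) t"
  by (cases t) (auto simp: assignment_fun_def)

lemma fst_eval_atom_t [simp]: "fst (eval_atom_t \<sigma> a) = map_atom (subst_tm (assignment_fun \<sigma>)) a"
  by (cases a) (auto simp: eval_atom_t_def split_def Let_def)

lemma set_var_list [simp]: "set (var_list As) = vars As"
  by (force simp: var_list_def vars_def tm_vars_def split: tm.splits)

lemma set_frontier_list [simp]: "set (frontier_list \<xi>) = frontier \<xi>"
  by (auto simp: frontier_list_def frontier_def)

lemma subst_cong:
  assumes "\<And>x. x \<in> vars As \<Longrightarrow> g x = h x"
  shows "subst g As = subst h As"
proof -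
  have "map_atom (subst_tm g) a = map_atom (subst_tm h) a" if "a \<in> set As" for a
  proof (cases a)
    case (Atom R ts)
    have "subst_tm g t = subst_tm h t" if "t \<in> set ts" for t
      using assms that \<open>a \<in> set As\<close> Atom by (cases t) (force simp: vars_def)+
    then show ?thesis using Atom by auto
  qed
  then show ?thesis by (auto simp: subst_def)
qed

lemma fst_body_holds_t: "fst (body_holds_t I \<xi> \<sigma>) \<longleftrightarrow> subst (assignment_fun \<sigma>) (body \<xi>) \<subseteq> set I"
  by (auto simp: body_holds_t_def split_def Let_def subst_def)

lemma fst_frontier_values_t:
  "fst (frontier_values_t \<xi> \<sigma>) = map (assignment_fun \<sigma>) (frontier_list \<xi>)"
  by (auto simp: frontier_values_t_def assignment_fun_def)

lemma fst_was_fired_t: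
  "fst (was_fired_t F \<xi> \<sigma>) \<longleftrightarrow> (\<xi>, map (assignment_fun \<sigma>) (frontier_list \<xi>)) \<in> set F"
  by (force simp: was_fired_t_def split_def Let_def fst_frontier_values_t)

lemma assignments_t_complete:
  assumes "\<And>x. x \<in> set xs \<Longrightarrow> h x \<in> set D"
  shows "map (\<lambda>x. (x, h x)) xs \<in> set (fst (assignments_t xs D))"
  using assms by (induction xs) (auto simp: split_def Let_def)

lemma assignment_fun_map:
  "x \<in> set xs \<Longrightarrow> assignment_fun (map (\<lambda>x. (x, h x)) xs) x = h x"
  by (induction xs) (auto simp: assignment_fun_def split_def Let_def)

lemma set_search_t:
  "set (fst (search_t \<Sigma>s I F)) =
     {(\<xi>, \<sigma>). \<xi> \<in> set \<Sigma>s \<and>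
        \<sigma> \<in> set (fst (assignments_t (var_list (body \<xi>)) (concat (map args I)))) \<and>
        subst (assignment_fun \<sigma>) (body \<xi>) \<subseteq> set I \<and>
        (\<xi>, map (assignment_fun \<sigma>) (frontier_list \<xi>)) \<notin> set F}"
  by (auto simp: search_t_def search_tgd_t_def split_def Let_def fst_body_holds_t fst_was_fired_t)

lemma trigger_in_dom:
  assumes "subst h As \<subseteq> I" "x \<in> vars As"
  shows "h x \<in> dom_inst I"
proof -
  obtain a where a: "a \<in> set As" "Var x \<in> set (args a)"
    using assms(2) by (auto simp: vars_def)
  have "map_atom (subst_tm h) a \<in> I"
    using assms(1) a(1) by (auto simp: subst_def)
  moreover have "h x \<in> set (args (map_atom (subst_tm h) a))"
    using a(2) by (cases a) force
  ultimately show ?thesis by (auto simp: dom_inst_def)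
qed

lemma set_insert_all_t [simp]: "set (fst (insert_all_t As I)) = set As \<union> set I"
  by (induction As) (auto simp: split_def Let_def)

lemma vars_append [simp]: "vars (As @ Bs) = vars As \<union> vars Bs"
  by (auto simp: vars_def)

lemma fire_t_correct:
  "set (fst (fst (fire_t I F \<xi> g))) = set I \<union> subst g (head \<xi>)"
  "snd (fst (fire_t I F \<xi> g)) = (\<xi>, map g (frontier_list \<xi>)) # F"
proof -
  let ?\<sigma> = "map (\<lambda>x. (x, g x)) (var_list (body \<xi> @ head \<xi>))"
  have eq: "assignment_fun ?\<sigma> x = g x" if "x \<in> vars (body \<xi>) \<union> vars (head \<xi>)" for x
    by (rule assignment_fun_map) (use that in simp)
  have "subst (assignment_fun ?\<sigma>) (head \<xi>) = subst g (head \<xi>)"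
    by (rule subst_cong) (use eq in auto)
  then show "set (fst (fst (fire_t I F \<xi> g))) = set I \<union> subst g (head \<xi>)"
    by (auto simp: fire_t_def split_def Let_def subst_def)
  show "snd (fst (fire_t I F \<xi> g)) = (\<xi>, map g (frontier_list \<xi>)) # F"
    using eq by (auto simp: fire_t_def split_def Let_def fst_frontier_values_t frontier_def)
qed

lemma run_t_correct:
  assumes "chase_sequence \<Sigma> I N S T H" "set Is = I" "enat n \<le> N"
  shows "set (fst (fst (run_t \<Sigma>s Is T H n))) = S n"
    and "set (snd (fst (run_t \<Sigma>s Is T H n))) =
           (\<lambda>j. (fst (T j), map (snd (T j)) (frontier_list (fst (T j))))) ` {..<n}"
proof -
  have "set (fst (fst (run_t \<Sigma>s Is T H n))) = S n \<and>
        set (snd (fst (run_t \<Sigma>s Is T H n))) =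
          (\<lambda>j. (fst (T j), map (snd (T j)) (frontier_list (fst (T j))))) ` {..<n}"
    using assms(3)
  proof (induction n)
    case 0
    then show ?case using assms by (auto simp: chase_sequence_def)
  next
    case (Suc n)
    have lt: "enat n < N" using Suc.prems by (simp add: Suc_ile_eq)
    then have fi: "fires (S n) (T n) (H n) (S (Suc n))"
      using assms(1) by (auto simp: chase_sequence_def)
    have keys: "map (H n) (frontier_list (fst (T n))) = map (snd (T n)) (frontier_list (fst (T n)))"
      using fi by (auto simp: fires_def uvars_def frontier_def)
    have IH: "set (fst (fst (run_t \<Sigma>s Is T H n))) = S n"
      "set (snd (fst (run_t \<Sigma>s Is T H n))) =
         (\<lambda>j. (fst (T j), map (snd (T j)) (frontier_list (fst (T j))))) ` {..<n}"
      using Suc.IH lt by auto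
    have "fst (run_t \<Sigma>s Is T H (Suc n)) =
        fst (fire_t (fst (fst (run_t \<Sigma>s Is T H n))) (snd (fst (run_t \<Sigma>s Is T H n))) (fst (T n)) (H n))"
      by (simp add: split_def Let_def)
    then show ?case
      using IH fi keys by (auto simp: fire_t_correct fires_def lessThan_Suc simp del: run_t.simps)
  qed
  then show "set (fst (fst (run_t \<Sigma>s Is T H n))) = S n"
    and "set (snd (fst (run_t \<Sigma>s Is T H n))) =
           (\<lambda>j. (fst (T j), map (snd (T j)) (frontier_list (fst (T j))))) ` {..<n}"
    by auto
qed

text \<open>The search finds exactly the active triggers, up to irrelevant values of the mapping.\<close>

lemma search_t_sound:
  assumes "chase_sequence \<Sigma> I N S T H" "set Is = I" "enat n \<le> N" "set \<Sigma>s = \<Sigma>"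
    and "run_t \<Sigma>s Is T H n = ((J, F), c)" "(\<xi>, \<sigma>) \<in> set (fst (search_t \<Sigma>s J F))"
  shows "active \<Sigma> S T n (\<xi>, assignment_fun \<sigma>)"
proof -
  have "set J = S n"
    and F: "set F = (\<lambda>j. (fst (T j), map (snd (T j)) (frontier_list (fst (T j))))) ` {..<n}"
    using run_t_correct[OF assms(1-3), of \<Sigma>s] assms(5) by auto
  moreover have "\<not> trigger_equiv (T j) (\<xi>, assignment_fun \<sigma>)" if "j < n" for j
  proof
    assume "trigger_equiv (T j) (\<xi>, assignment_fun \<sigma>)"
    then have "(\<xi>, map (assignment_fun \<sigma>) (frontier_list \<xi>)) =
        (fst (T j), map (snd (T j)) (frontier_list (fst (T j))))"
      by (auto simp: trigger_equiv_def)
    then have "(\<xi>, map (assignment_fun \<sigma>) (frontier_list \<xi>)) \<in> set F"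
      unfolding F using that by blast
    then show False using assms(6) by (simp add: set_search_t)
  qed
  ultimately show ?thesis
    using assms(4,6) by (auto simp: active_def is_trigger_def set_search_t)
qed

lemma search_t_complete:
  assumes "chase_sequence \<Sigma> I N S T H" "set Is = I" "enat n \<le> N" "set \<Sigma>s = \<Sigma>"
    and "run_t \<Sigma>s Is T H n = ((J, F), c)" "active \<Sigma> S T n (\<xi>, h)"
  shows "\<exists>\<sigma>. (\<xi>, \<sigma>) \<in> set (fst (search_t \<Sigma>s J F)) \<and> (\<forall>x\<in>uvars \<xi>. assignment_fun \<sigma> x = h x)"
proof -
  have J: "set J = S n"
    and F: "set F = (\<lambda>j. (fst (T j), map (snd (T j)) (frontier_list (fst (T j))))) ` {..<n}"
    using run_t_correct[OF assms(1-3), of \<Sigma>s] assms(5) by auto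
  define \<sigma> where "\<sigma> = map (\<lambda>x. (x, h x)) (var_list (body \<xi>))"
  have eq: "assignment_fun \<sigma> x = h x" if "x \<in> vars (body \<xi>)" for x
    unfolding \<sigma>_def by (rule assignment_fun_map) (use that in simp)
  have trig: "\<xi> \<in> \<Sigma>" "subst h (body \<xi>) \<subseteq> set J"
    using assms(6) J by (auto simp: active_def is_trigger_def)
  have keys: "map (assignment_fun \<sigma>) (frontier_list \<xi>) = map h (frontier_list \<xi>)"
    using eq by (auto simp: frontier_def)
  have "(\<xi>, map (assignment_fun \<sigma>) (frontier_list \<xi>)) \<notin> set F"
    unfolding keys using assms(6) by (auto simp: F active_def trigger_equiv_def)
  moreover have "subst (assignment_fun \<sigma>) (body \<xi>) \<subseteq> set J"
    using trig(2) subst_cong[of "body \<xi>" "assignment_fun \<sigma>" h] eq by auto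
  moreover have "\<sigma> \<in> set (fst (assignments_t (var_list (body \<xi>)) (concat (map args J))))"
    unfolding \<sigma>_def
    by (rule assignments_t_complete) (use trigger_in_dom[OF trig(2)] in \<open>auto simp: dom_inst_def\<close>)
  ultimately have "(\<xi>, \<sigma>) \<in> set (fst (search_t \<Sigma>s J F))"
    using trig(1) assms(4) by (simp add: set_search_t del: map_eq_conv)
  then show ?thesis using eq by (auto simp: uvars_def)
qed

end

(*
  Give every unaffected position level 0 and every affected position p level 1 + the number of
  sources of special edges from which p is reachable.  Without cycles through special edges, levels
  do not decrease along normal edges and increase along special ones.  Generation 0 consists of the
  values of the instance and the constants of the tgds; generation k + 1 adds the nulls created by
  triggers all of whose frontier values lie in generation k.  By induction along the chase, a
  position of level k only holds values of generation k.  Since each trigger class fires once and is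
  determined by its frontier values, generation k + 1 is polynomially bounded in generation k, and
  the number of levels depends on the tgds only.  Hence the number of steps is polynomial, and so is
  the size of the state, on which one step costs polynomial time for fixed tgds.
*)

theory Submission
  imports Defs
begin

section \<open>Polynomially bounded functions\<close>

text \<open>The bound is required at every argument, not only eventually. Coefficients are natural
  numbers, which makes the bounding polynomial monotone.\<close>

definition poly_bounded :: "(nat \<Rightarrow> nat) \<Rightarrow> bool" where
  "poly_bounded f \<longleftrightarrow> (\<exists>p. \<forall>x. f x \<le> poly p x)"

lemma poly_nat_mono: "x \<le> y \<Longrightarrow> poly p x \<le> poly p (y :: nat)"
  by (induction p) (auto intro: add_mono mult_mono)

lemma poly_bounded_const: "poly_bounded (\<lambda>_. c)"
  unfolding poly_bounded_def by (rule exI[of _ "[:c:]"]) simp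

lemma poly_bounded_id: "poly_bounded (\<lambda>x. x)"
  unfolding poly_bounded_def by (rule exI[of _ "[:0, 1:]"]) simp

lemma poly_bounded_add:
  assumes "poly_bounded f" "poly_bounded g"
  shows "poly_bounded (\<lambda>x. f x + g x)"
proof -
  obtain p q where "\<And>x. f x \<le> poly p x" "\<And>x. g x \<le> poly q x"
    using assms unfolding poly_bounded_def by blast
  then have "\<forall>x. f x + g x \<le> poly (p + q) x" by (simp add: add_mono)
  then show ?thesis unfolding poly_bounded_def by blast
qed

lemma poly_bounded_mult:
  assumes "poly_bounded f" "poly_bounded g"
  shows "poly_bounded (\<lambda>x. f x * g x)"
proof -
  obtain p q where "\<And>x. f x \<le> poly p x" "\<And>x. g x \<le> poly q x"
    using assms unfolding poly_bounded_def by blast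
  then have "\<forall>x. f x * g x \<le> poly (p * q) x" by (simp add: mult_mono)
  then show ?thesis unfolding poly_bounded_def by blast
qed

lemma poly_bounded_Suc: "poly_bounded f \<Longrightarrow> poly_bounded (\<lambda>x. Suc (f x))"
  using poly_bounded_add[OF _ poly_bounded_const[of 1]] by simp

lemma poly_bounded_power: "poly_bounded f \<Longrightarrow> poly_bounded (\<lambda>x. f x ^ k)"
  by (induction k) (auto intro: poly_bounded_const poly_bounded_mult)

text \<open>The polynomial bounding \<open>f\<close> is monotone, so the bound for \<open>g\<close>
  may be substituted into it.\<close>

lemma poly_bounded_compose:
  assumes "poly_bounded f" "poly_bounded g"
  shows "poly_bounded (\<lambda>x. f (g x))"
proof -
  obtain p q where pq: "\<And>x. f x \<le> poly p x" "\<And>x. g x \<le> poly q x"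
    using assms unfolding poly_bounded_def by blast
  then have "\<forall>x. f (g x) \<le> poly (pcompose p q) x"
    by (metis poly_pcompose poly_nat_mono order_trans)
  then show ?thesis unfolding poly_bounded_def by blast
qed

lemma poly_bounded_sum:
  "(\<And>a. a \<in> A \<Longrightarrow> poly_bounded (f a)) \<Longrightarrow> poly_bounded (\<lambda>x. \<Sum>a\<in>A. f a x)"
  by (induction A rule: infinite_finite_induct) (auto intro: poly_bounded_const poly_bounded_add)

lemma poly_bounded_sum_list:
  "(\<And>a. a \<in> set as \<Longrightarrow> poly_bounded (f a)) \<Longrightarrow> poly_bounded (\<lambda>x. \<Sum>a\<leftarrow>as. f a x)"
  by (induction as) (auto intro: poly_bounded_const poly_bounded_add)

lemmas poly_bounded_intros = poly_bounded_const poly_bounded_id poly_bounded_add poly_bounded_mult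
  poly_bounded_Suc poly_bounded_power poly_bounded_sum poly_bounded_sum_list

section \<open>Levels of positions\<close>

text \<open>The propagation graph is a subgraph of the dependency graph, and its special edges are
  generating edges; a bad cycle in the former is thus one in the latter.\<close>

lemma WA_subset_SD: "WA ar \<subseteq> SD ar"
proof
  fix \<Sigma> assume \<Sigma>: "\<Sigma> \<in> WA ar"
  have sub: "normal_edges \<Sigma> \<subseteq> copy_edges \<Sigma>" "special_edges \<Sigma> \<subseteq> generating_edges \<Sigma>"
    unfolding normal_edges_def copy_edges_def special_edges_def generating_edges_def by blast+
  then have "(normal_edges \<Sigma> \<union> special_edges \<Sigma>)\<^sup>* \<subseteq> (copy_edges \<Sigma> \<union> generating_edges \<Sigma>)\<^sup>*"
    by (intro rtrancl_mono Un_mono)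
  with sub \<Sigma> show "\<Sigma> \<in> SD ar"
    unfolding WA_def SD_def cycle_through_def by blast
qed

section \<open>Positions of variables and finiteness of the special edges\<close>

lemma finite_vars: "finite (vars As)"
  by (metis List.finite_set set_var_list)

lemma finite_positions_of: "finite (positions_of x As)"
proof -
  have "positions_of x As \<subseteq> (\<Union>a\<in>set As. (\<lambda>i. (rel a, i)) ` {..length (args a)})"
    unfolding positions_of_def by auto
  then show ?thesis by (rule finite_subset) auto
qed

lemma vars_iff_positions: "(x \<in> vars As) \<longleftrightarrow> positions_of x As \<noteq> {}"
proof
  assume "x \<in> vars As"
  then obtain a where "a \<in> set As" "Var x \<in> set (args a)" by (auto simp: vars_def)
  then obtain i where "a \<in> set As" "i < length (args a)" "args a ! i = Var x"
    by (auto simp: in_set_conv_nth)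
  then have "(rel a, Suc i) \<in> positions_of x As"
    unfolding positions_of_def by force
  then show "positions_of x As \<noteq> {}" by blast
next
  assume "positions_of x As \<noteq> {}"
  then obtain a i where "a \<in> set As" "1 \<le> i" "i \<le> length (args a)" "args a ! (i - 1) = Var x"
    unfolding positions_of_def by blast
  moreover from this have "args a ! (i - 1) \<in> set (args a)" by (intro nth_mem) auto
  ultimately show "x \<in> vars As" unfolding vars_def by auto
qed

lemma finite_special_edges:
  assumes "finite \<Sigma>"
  shows "finite (special_edges \<Sigma>)"
proof -
  have "special_edges \<Sigma> \<subseteq> (\<Union>\<xi>\<in>\<Sigma>. \<Union>x\<in>frontier \<xi>. \<Union>z\<in>evars \<xi>.
      positions_of x (body \<xi>) \<times> positions_of z (head \<xi>))"
    unfolding special_edges_def by blast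
  then show ?thesis
    by (rule finite_subset)
       (use assms in \<open>auto simp: frontier_def evars_def finite_vars finite_positions_of\<close>)
qed

section \<open>Levels and their behaviour along the edges of the propagation graph\<close>

definition special_predecessors :: "'r tgd set \<Rightarrow> 'r position \<Rightarrow> 'r position set" where
  "special_predecessors \<Sigma> p =
     {q. \<exists>q'. (q, q') \<in> special_edges \<Sigma> \<and> (q', p) \<in> (normal_edges \<Sigma> \<union> special_edges \<Sigma>)\<^sup>*}"

text \<open>Counting a finite set of sources avoids a maximum over paths: monotonicity comes from
  inclusion of the sets, strict growth from strict inclusion.\<close>

definition level :: "'r tgd set \<Rightarrow> 'r position \<Rightarrow> nat" where
  "level \<Sigma> p = (if p \<in> affected \<Sigma> then Suc (card (special_predecessors \<Sigma> p)) else 0)"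

lemma special_predecessors_subset: "special_predecessors \<Sigma> p \<subseteq> Domain (special_edges \<Sigma>)"
  unfolding special_predecessors_def by blast

lemma finite_special_predecessors: "finite \<Sigma> \<Longrightarrow> finite (special_predecessors \<Sigma> p)"
  by (meson finite_special_edges finite_Domain finite_subset special_predecessors_subset)

lemma special_predecessors_mono:
  assumes "(p, q) \<in> normal_edges \<Sigma> \<union> special_edges \<Sigma>"
  shows "special_predecessors \<Sigma> p \<subseteq> special_predecessors \<Sigma> q"
  using assms unfolding special_predecessors_def by (blast intro: rtrancl_into_rtrancl)

lemma level_le:
  assumes "finite \<Sigma>"
  shows "level \<Sigma> p \<le> Suc (card (Domain (special_edges \<Sigma>)))"
  using card_mono[OF finite_Domain[OF finite_special_edges[OF assms]] special_predecessors_subset]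
  by (simp add: level_def)

text \<open>The variable behind a normal edge is confined to affected positions in the body, so the
  target is affected too; and each path into the source extends along the edge.\<close>

lemma level_normal_edge:
  assumes "finite \<Sigma>" "(p, q) \<in> normal_edges \<Sigma>"
  shows "level \<Sigma> p \<le> level \<Sigma> q"
proof -
  have "q \<in> affected \<Sigma>"
    using assms(2) by (auto simp: normal_edges_def frontier_def uvars_def intro: affected.propagate)
  moreover have "card (special_predecessors \<Sigma> p) \<le> card (special_predecessors \<Sigma> q)"
    using assms by (intro card_mono finite_special_predecessors special_predecessors_mono) auto
  ultimately show ?thesis by (simp add: level_def)
qed

lemma level_special_edge:
  assumes "finite \<Sigma>" "\<not> cycle_through (normal_edges \<Sigma>) (special_edges \<Sigma>)"
    and pq: "(p, q) \<in> special_edges \<Sigma>"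
  shows "level \<Sigma> p < level \<Sigma> q"
proof -
  have "q \<in> affected \<Sigma>"
    using pq by (auto simp: special_edges_def intro: affected.existential)
  \<comment> \<open>The special edge itself, followed by the empty path.\<close>
  moreover have "p \<in> special_predecessors \<Sigma> q"
    using pq unfolding special_predecessors_def by blast
  \<comment> \<open>Otherwise some special edge leaving \<open>p\<close> would lead back to
    \<open>p\<close>.\<close>
  moreover have "p \<notin> special_predecessors \<Sigma> p"
    using assms(2) unfolding special_predecessors_def cycle_through_def by blast
  ultimately have "special_predecessors \<Sigma> p \<subset> special_predecessors \<Sigma> q"
    using special_predecessors_mono[of p q \<Sigma>] pq by blast
  then have "card (special_predecessors \<Sigma> p) < card (special_predecessors \<Sigma> q)"
    using assms(1) by (intro psubset_card_mono finite_special_predecessors)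
  with \<open>q \<in> affected \<Sigma>\<close> show ?thesis by (simp add: level_def)
qed

section \<open>Generations of values\<close>

text \<open>Constants can enter an instance only through heads; a constant in a body is matched
  against a fact that is already present.\<close>

definition head_constants :: "'r tgd set \<Rightarrow> value set" where
  "head_constants \<Sigma> = Const ` (\<Union>\<xi>\<in>\<Sigma>. \<Union>a\<in>set (head \<xi>). Cst -` set (args a))"

lemma finite_head_constants: "finite \<Sigma> \<Longrightarrow> finite (head_constants \<Sigma>)"
  unfolding head_constants_def by (intro finite_imageI finite_UN_I finite_vimageI) (auto intro: injI)

text \<open>The number of pairs of a tgd and a tuple of frontier values drawn from \<open>d\<close>
  values, hence of possible trigger classes over such values.\<close>

definition num_classes :: "'r tgd set \<Rightarrow> nat \<Rightarrow> nat" where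
  "num_classes \<Sigma> d = (\<Sum>\<xi>\<in>\<Sigma>. d ^ length (frontier_list \<xi>))"

lemma num_classes_mono: "d \<le> e \<Longrightarrow> num_classes \<Sigma> d \<le> num_classes \<Sigma> e"
  unfolding num_classes_def by (intro sum_mono power_mono) auto

lemma poly_bounded_num_classes: "poly_bounded (num_classes \<Sigma>)"
  unfolding num_classes_def by (intro poly_bounded_intros)

text \<open>A fired class creates at most one null per existential variable of its tgd; the sum over
  all tgds bounds this uniformly.\<close>

primrec generation_bound :: "'r tgd set \<Rightarrow> nat \<Rightarrow> nat \<Rightarrow> nat" where
  "generation_bound \<Sigma> b 0 = b + card (head_constants \<Sigma>)"
| "generation_bound \<Sigma> b (Suc k) = generation_bound \<Sigma> b k +
     num_classes \<Sigma> (generation_bound \<Sigma> b k) * (\<Sum>\<xi>\<in>\<Sigma>. card (evars \<xi>))"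

text \<open>For fixed \<open>k\<close> only finitely many polynomials are composed. The degree may
  grow with \<open>k\<close>, but the \<open>k\<close> used later depends on \<Sigma> alone.\<close>

lemma poly_bounded_generation_bound: "poly_bounded (\<lambda>b. generation_bound \<Sigma> b k)"
  by (induction k)
     (auto intro!: poly_bounded_intros poly_bounded_compose[OF poly_bounded_num_classes])

text \<open>The generation chosen here is the largest possible level, by
  \<open>level_le\<close>.\<close>

definition step_bound :: "'r tgd set \<Rightarrow> nat \<Rightarrow> nat" where
  "step_bound \<Sigma> b =
     num_classes \<Sigma> (generation_bound \<Sigma> b (Suc (card (Domain (special_edges \<Sigma>)))))"

lemma poly_bounded_step_bound: "poly_bounded (step_bound \<Sigma>)"
  unfolding step_bound_def
  by (intro poly_bounded_compose[OF poly_bounded_num_classes] poly_bounded_generation_bound)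

lemma finite_dom_inst: "finite I \<Longrightarrow> finite (dom_inst I)"
  by (simp add: dom_inst_def)

lemma card_dom_inst_le:
  assumes "finite I"
  shows "card (dom_inst I) \<le> inst_size I"
proof -
  have "card (dom_inst I) \<le> (\<Sum>a\<in>I. card (set (args a)))"
    unfolding dom_inst_def by (rule card_UN_le[OF assms])
  also have "\<dots> \<le> inst_size I"
    unfolding inst_size_def by (intro sum_mono) (simp add: card_length le_SucI)
  finally show ?thesis .
qed

section \<open>Generations along one chase sequence\<close>

locale chase =
  fixes \<Sigma> :: "'r tgd set" and I :: "'r fact set" and N :: enat
    and S :: "nat \<Rightarrow> 'r fact set" and T :: "nat \<Rightarrow> 'r trigger" and H :: "nat \<Rightarrow> nat \<Rightarrow> value"
  assumes finite_tgds: "finite \<Sigma>"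
    and finite_start: "finite I"
    and sequence: "chase_sequence \<Sigma> I N S T H"
begin

abbreviation frontier_image :: "nat \<Rightarrow> value set" where
  "frontier_image i \<equiv> snd (T i) ` frontier (fst (T i))"

lemma start: "S 0 = I"
  using sequence by (simp add: chase_sequence_def)

lemma step:
  assumes "enat i < N"
  shows "fst (T i) \<in> \<Sigma>" "subst (snd (T i)) (body (fst (T i))) \<subseteq> S i"
    "S (Suc i) = S i \<union> subst (H i) (head (fst (T i)))"
    "x \<in> uvars (fst (T i)) \<Longrightarrow> H i x = snd (T i) x"
  using assms sequence unfolding chase_sequence_def active_def is_trigger_def fires_def by blast+

lemma not_equiv:
  assumes "enat j < N" "i < j"
  shows "\<not> trigger_equiv (T i) (T j)"
  using assms sequence unfolding chase_sequence_def active_def by blast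

text \<open>The union ranges over all steps of the sequence, early or late: a generation measures
  the nesting depth of null creation, not time.\<close>

primrec generation :: "nat \<Rightarrow> value set" where
  "generation 0 = dom_inst I \<union> head_constants \<Sigma>"
| "generation (Suc k) = generation k \<union>
     (\<Union>i\<in>{i. enat i < N \<and> frontier_image i \<subseteq> generation k}. H i ` evars (fst (T i)))"

lemma generation_mono: "k \<le> l \<Longrightarrow> generation k \<subseteq> generation l"
  by (induction l rule: dec_induct) auto

text \<open>Steps are determined by the classes of their triggers, and these by the frontier values.\<close>

lemma steps_within:
  assumes "finite D"
  shows "finite {i. enat i < N \<and> frontier_image i \<subseteq> D}" (is "finite ?A")
    and "card {i. enat i < N \<and> frontier_image i \<subseteq> D} \<le> num_classes \<Sigma> (card D)"
proof -
  let ?B = "SIGMA \<xi>:\<Sigma>. {vs. set vs \<subseteq> D \<and> length vs = length (frontier_list \<xi>)}"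
  \<comment> \<open>The key of a trigger class: since \<open>frontier_list\<close> enumerates the
    frontier, equal keys force equivalent triggers.\<close>
  let ?f = "\<lambda>i. (fst (T i), map (snd (T i)) (frontier_list (fst (T i))))"
  have "inj_on ?f ?A"
  proof (rule linorder_inj_onI)
    fix i j assume "i < j" "i \<in> ?A" "j \<in> ?A"
    then have "\<not> trigger_equiv (T i) (T j)" using not_equiv by blast
    then show "?f i \<noteq> ?f j" by (auto simp: trigger_equiv_def)
  qed auto
  moreover have "?f ` ?A \<subseteq> ?B"
    using step(1) by auto
  moreover have fin: "finite ?B"
    using finite_tgds assms by (auto intro!: finite_lists_length_eq)
  ultimately show "finite ?A" by (meson inj_on_finite)
  have "card ?A \<le> card ?B"
    using \<open>inj_on ?f ?A\<close> \<open>?f ` ?A \<subseteq> ?B\<close> fin by (rule card_inj_on_le)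
  also have "card ?B = num_classes \<Sigma> (card D)"
    using finite_tgds assms
    by (subst card_SigmaI) (auto simp: num_classes_def card_lists_length_eq finite_lists_length_eq)
  finally show "card ?A \<le> num_classes \<Sigma> (card D)" .
qed

lemma card_evars_le: "\<xi> \<in> \<Sigma> \<Longrightarrow> card (evars \<xi>) \<le> (\<Sum>\<xi>\<in>\<Sigma>. card (evars \<xi>))"
  using finite_tgds by (intro member_le_sum) auto

text \<open>Finiteness is proved along with the bound because \<open>steps_within\<close> counts
  steps only over a finite set of frontier values.\<close>

lemma generation_finite_card:
  "finite (generation k) \<and> card (generation k) \<le> generation_bound \<Sigma> (inst_size I) k"
proof (induction k)
  case 0
  have "card (dom_inst I \<union> head_constants \<Sigma>) \<le> card (dom_inst I) + card (head_constants \<Sigma>)"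
    by (rule card_Un_le)
  then show ?case
    using card_dom_inst_le[OF finite_start] finite_dom_inst[OF finite_start]
      finite_head_constants[OF finite_tgds] by simp
next
  case (Suc k)
  let ?A = "{i. enat i < N \<and> frontier_image i \<subseteq> generation k}"
  let ?U = "\<Union>i\<in>?A. H i ` evars (fst (T i))"
  let ?e = "\<Sum>\<xi>\<in>\<Sigma>. card (evars \<xi>)"
  have A: "finite ?A" "card ?A \<le> num_classes \<Sigma> (card (generation k))"
    using steps_within Suc.IH by auto
  have "card ?U \<le> (\<Sum>i\<in>?A. card (H i ` evars (fst (T i))))"
    by (rule card_UN_le[OF A(1)])
  also have "\<dots> \<le> (\<Sum>i\<in>?A. ?e)"
  proof (rule sum_mono)
    fix i assume "i \<in> ?A"
    then have "card (evars (fst (T i))) \<le> ?e" using card_evars_le step(1) by blast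
    then show "card (H i ` evars (fst (T i))) \<le> ?e"
      using card_image_le[of "evars (fst (T i))" "H i"] by (simp add: evars_def finite_vars)
  qed
  \<comment> \<open>The induction hypothesis enters through monotonicity of
    \<open>num_classes\<close>.\<close>
  also have "\<dots> \<le> num_classes \<Sigma> (generation_bound \<Sigma> (inst_size I) k) * ?e"
    using order_trans[OF A(2) num_classes_mono] Suc.IH by simp
  finally have "card ?U \<le> \<dots>" .
  moreover have "card (generation (Suc k)) \<le> card (generation k) + card ?U"
    by (simp add: card_Un_le)
  moreover have "finite ?U"
    using A(1) by (auto simp: evars_def finite_vars)
  ultimately show ?case using Suc.IH by simp
qed

section \<open>The level of a position bounds the generation of its values\<close>

text \<open>Existential variables only occur in affected positions, so values at level 0 are not new.\<close>

definition well_leveled :: "'r fact \<Rightarrow> bool" where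
  "well_leveled a \<longleftrightarrow> (\<forall>i<length (args a). args a ! i \<in> generation (level \<Sigma> (rel a, Suc i)))"

text \<open>The image of a body atom is a well-leveled fact that carries the image of
  \<open>x\<close> at position \<open>p\<close>.\<close>

lemma trigger_value:
  assumes "\<And>a. a \<in> subst h (body \<xi>) \<Longrightarrow> well_leveled a" "p \<in> positions_of x (body \<xi>)"
  shows "h x \<in> generation (level \<Sigma> p)"
proof -
  obtain a i where a: "p = (rel a, i)" "a \<in> set (body \<xi>)" "1 \<le> i" "i \<le> length (args a)"
      "args a ! (i - 1) = Var x"
    using assms(2) unfolding positions_of_def by blast
  have "map_atom (subst_tm h) a \<in> subst h (body \<xi>)" using a(2) by (simp add: subst_def)
  then have "well_leveled (map_atom (subst_tm h) a)" by (rule assms(1))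
  \<comment> \<open>Positions count from 1 and list indices from 0; \<open>Suc (i - 1)\<close> is
    \<open>i\<close> because \<open>1 \<le> i\<close>.\<close>
  then have "args (map_atom (subst_tm h) a) ! (i - 1)
      \<in> generation (level \<Sigma> (rel (map_atom (subst_tm h) a), Suc (i - 1)))"
    using a(3,4) unfolding well_leveled_def
    by (metis One_nat_def Suc_le_lessD Suc_pred atom.map_sel(2) diff_Suc_1 length_map less_eq_Suc_le)
  moreover have "args (map_atom (subst_tm h) a) ! (i - 1) = h x"
    using a(3-5) by (simp add: atom.map_sel)
  ultimately show ?thesis using a(1,3) by (simp add: atom.map_sel)
qed

text \<open>The alternatives match the propagation graph: its edges leave exactly those body
  positions whose variable is confined to affected positions. Any other variable has an unaffected
  body position, which has level 0.\<close>

lemma frontier_value: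
  assumes "\<And>a. a \<in> subst h (body \<xi>) \<Longrightarrow> well_leveled a" "x \<in> uvars \<xi>"
  obtains "h x \<in> generation 0"
  | q where "positions_of x (body \<xi>) \<subseteq> affected \<Sigma>" "q \<in> positions_of x (body \<xi>)"
      "h x \<in> generation (level \<Sigma> q)"
proof (cases "positions_of x (body \<xi>) \<subseteq> affected \<Sigma>")
  case True
  obtain q where "q \<in> positions_of x (body \<xi>)"
    using assms(2) by (auto simp: uvars_def vars_iff_positions)
  then show ?thesis using that(2) True trigger_value[OF assms(1)] by blast
next
  case False
  then obtain q where "q \<in> positions_of x (body \<xi>)" "level \<Sigma> q = 0"
    unfolding level_def by (metis subsetI)
  then show ?thesis using that(1) trigger_value[OF assms(1)] by metis
qed

text \<open>A head term is of one of three kinds. Constants belong to generation 0, frontier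
  variables are handled by normal edges, and existential variables by special edges from the
  frontier.\<close>

lemma head_well_leveled:
  assumes safe: "\<not> cycle_through (normal_edges \<Sigma>) (special_edges \<Sigma>)"
    and i: "enat i < N" and IH: "\<And>a. a \<in> S i \<Longrightarrow> well_leveled a"
    and b: "b \<in> set (head (fst (T i)))"
  shows "well_leveled (map_atom (subst_tm (H i)) b)"
proof -
  define \<xi> h where "\<xi> = fst (T i)" and "h = snd (T i)"
  have \<xi>: "\<xi> \<in> \<Sigma>" and body: "\<And>a. a \<in> subst h (body \<xi>) \<Longrightarrow> well_leveled a"
    using step(1,2)[OF i] IH by (auto simp: \<xi>_def h_def)
  have "subst_tm (H i) (args b ! j) \<in> generation (level \<Sigma> (rel b, Suc j))"
    if j: "j < length (args b)" for j
  proof (cases "args b ! j")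
    case (Cst c)
    then have "Cst c \<in> set (args b)" using j nth_mem by metis
    then have "Const c \<in> head_constants \<Sigma>"
      using b \<xi> by (auto simp: head_constants_def \<xi>_def)
    then show ?thesis
      using Cst generation_mono[of 0 "level \<Sigma> (rel b, Suc j)"] by auto
  next
    case (Var x)
    let ?p = "(rel b, Suc j)"
    have p: "?p \<in> positions_of x (head \<xi>)"
      using b j Var unfolding positions_of_def \<xi>_def by force
    then have xh: "x \<in> vars (head \<xi>)" using vars_iff_positions by blast
    have "H i x \<in> generation (level \<Sigma> ?p)"
    proof (cases "x \<in> uvars \<xi>")
      case True
      then have fr: "x \<in> frontier \<xi>" and Hx: "H i x = h x"
        using xh step(4)[OF i] by (auto simp: frontier_def uvars_def \<xi>_def h_def)
      consider "h x \<in> generation 0"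
        | q where "positions_of x (body \<xi>) \<subseteq> affected \<Sigma>" "q \<in> positions_of x (body \<xi>)"
            "h x \<in> generation (level \<Sigma> q)"
        using frontier_value[of h \<xi> x] body True by blast
      then show ?thesis
      proof cases
        case 1
        then show ?thesis using Hx generation_mono[of 0 "level \<Sigma> ?p"] by auto
      next
        case (2 q)
        then have "(q, ?p) \<in> normal_edges \<Sigma>"
          using \<xi> fr p unfolding normal_edges_def by blast
        then show ?thesis
          using level_normal_edge[OF finite_tgds] generation_mono 2(3) Hx by (metis subsetD)
      qed
    next
      case False
      then have ev: "x \<in> evars \<xi>" using xh by (auto simp: evars_def uvars_def)
      then have "?p \<in> affected \<Sigma>" using \<xi> p by (blast intro: affected.existential)
      \<comment> \<open>An affected position has positive level, which leaves room for the
        generation before it.\<close>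
      then obtain k where k: "level \<Sigma> ?p = Suc k" by (simp add: level_def)
      \<comment> \<open>Every frontier value lies in generation 0 or stems from the source of a
        special edge into \<open>?p\<close>, whose level is at most \<open>k\<close>. An empty
        frontier satisfies this vacuously.\<close>
      have "h y \<in> generation k" if y: "y \<in> frontier \<xi>" for y
      proof -
        have y': "y \<in> uvars \<xi>" using y by (simp add: frontier_def uvars_def)
        consider "h y \<in> generation 0"
          | q where "positions_of y (body \<xi>) \<subseteq> affected \<Sigma>" "q \<in> positions_of y (body \<xi>)"
              "h y \<in> generation (level \<Sigma> q)"
          using frontier_value[of h \<xi> y] body y' by blast
        then show ?thesis
        proof cases
          case 1
          then show ?thesis using generation_mono[of 0 k] by auto
        next
          case (2 q)
          then have "(q, ?p) \<in> special_edges \<Sigma>"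
            using \<xi> y ev p unfolding special_edges_def by blast
          then have "level \<Sigma> q \<le> k"
            using level_special_edge[OF finite_tgds safe] k by fastforce
          then show ?thesis using generation_mono 2(3) by blast
        qed
      qed
      \<comment> \<open>So step \<open>i\<close> is among those whose nulls make up generation
        \<open>Suc k\<close>.\<close>
      then have "frontier_image i \<subseteq> generation k" by (auto simp: \<xi>_def h_def)
      then show ?thesis using i ev unfolding k \<xi>_def by auto
    qed
    then show ?thesis using Var by simp
  qed
  then show ?thesis unfolding well_leveled_def by (cases b) auto
qed

lemma facts_well_leveled:
  assumes "\<not> cycle_through (normal_edges \<Sigma>) (special_edges \<Sigma>)" "enat n \<le> N" "a \<in> S n"
  shows "well_leveled a"
  using assms(2,3)
proof (induction n arbitrary: a)
  case 0
  then have "set (args a) \<subseteq> generation 0" using start by (auto simp: dom_inst_def)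
  then show ?case
    using generation_mono[OF le0] unfolding well_leveled_def by (meson nth_mem subsetD)
next
  case (Suc n)
  have n: "enat n < N" using Suc.prems(1) by (simp add: Suc_ile_eq)
  then have IH: "\<And>a. a \<in> S n \<Longrightarrow> well_leveled a" using Suc.IH by simp
  show ?case
    using Suc.prems(2) IH head_well_leveled[OF assms(1) n IH]
    unfolding step(3)[OF n] subst_def by auto
qed

text \<open>All values that ever occur lie in generation \<open>K\<close>, so
  \<open>steps_within\<close> counts every step. The bound does not mention \<open>N\<close>, which
  is how it excludes infinite sequences.\<close>

lemma steps_le:
  assumes safe: "\<not> cycle_through (normal_edges \<Sigma>) (special_edges \<Sigma>)" and n: "enat n \<le> N"
  shows "n \<le> step_bound \<Sigma> (inst_size I)"
proof -
  define K where "K = Suc (card (Domain (special_edges \<Sigma>)))"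
  let ?A = "{i. enat i < N \<and> frontier_image i \<subseteq> generation K}"
  have dom: "dom_inst (S i) \<subseteq> generation K" if "enat i \<le> N" for i
  proof
    fix v assume "v \<in> dom_inst (S i)"
    then obtain a j where a: "a \<in> S i" "j < length (args a)" "v = args a ! j"
      by (auto simp: dom_inst_def in_set_conv_nth)
    then have "v \<in> generation (level \<Sigma> (rel a, Suc j))"
      using facts_well_leveled[OF safe that] by (auto simp: well_leveled_def)
    then show "v \<in> generation K"
      using generation_mono level_le[OF finite_tgds] unfolding K_def by blast
  qed
  have "{..<n} \<subseteq> ?A"
  proof
    fix i assume "i \<in> {..<n}"
    then have "enat i < enat n" by simp
    then have i: "enat i < N" using n by (rule order_less_le_trans)
    \<comment> \<open>Frontier variables occur in the body, and the body is matched in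
      \<open>S i\<close>.\<close>
    have "frontier_image i \<subseteq> dom_inst (S i)"
      using trigger_in_dom[OF step(2)[OF i]] by (auto simp: frontier_def)
    then show "i \<in> ?A" using i dom[of i] by (auto dest: order_less_imp_le)
  qed
  then have "card {..<n} \<le> card ?A"
    using steps_within(1) generation_finite_card by (intro card_mono) auto
  also have "\<dots> \<le> num_classes \<Sigma> (card (generation K))"
    using steps_within(2) generation_finite_card by blast
  also have "\<dots> \<le> step_bound \<Sigma> (inst_size I)"
    unfolding step_bound_def K_def using generation_finite_card by (blast intro: num_classes_mono)
  finally show ?thesis by simp
qed

text \<open>An infinite sequence would have one step more than \<open>steps_le\<close> permits; a
  finite one has no active trigger at its end, by definition.\<close>

lemma safe_terminates:
  assumes "\<not> cycle_through (normal_edges \<Sigma>) (special_edges \<Sigma>)"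
  obtains n where "N = enat n" "terminates_at \<Sigma> N S T n" "n \<le> step_bound \<Sigma> (inst_size I)"
proof (cases N)
  case (enat n)
  then show ?thesis
    using that sequence steps_le[OF assms] by (auto simp: chase_sequence_def terminates_at_def)
next
  case infinity
  then show ?thesis using steps_le[OF assms, of "Suc (step_bound \<Sigma> (inst_size I))"] by simp
qed

end

section \<open>Running time\<close>

lemma cost_map_t_le:
  "(\<And>x. x \<in> set xs \<Longrightarrow> snd (f x) \<le> c) \<Longrightarrow> snd (map_t f xs) \<le> length xs * (c + 1) + 1"
  by (induction xs) (fastforce simp: split_def Let_def)+

lemma cost_filter_t_le:
  "(\<And>x. x \<in> set xs \<Longrightarrow> snd (P x) \<le> c) \<Longrightarrow> snd (filter_t P xs) \<le> length xs * (c + 1) + 1"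
  by (induction xs) (fastforce simp: split_def Let_def)+

lemma cost_all_t_le:
  "(\<And>x. x \<in> set xs \<Longrightarrow> snd (P x) \<le> c) \<Longrightarrow> snd (all_t P xs) \<le> length xs * (c + 1) + 1"
  by (induction xs) (fastforce simp: split_def Let_def)+

lemma cost_ex_t_le:
  "(\<And>x. x \<in> set xs \<Longrightarrow> snd (P x) \<le> c) \<Longrightarrow> snd (ex_t P xs) \<le> length xs * (c + 1) + 1"
  by (induction xs) (fastforce simp: split_def Let_def)+

lemma cost_append_t: "snd (append_t xs ys) = length xs + 1"
  by (induction xs) (auto simp: split_def Let_def)

text \<open>Appending costs the length of its left argument plus 1, and the recursive call costs 1
  more; hence the lengths of the results and the summand 2.\<close>

lemma cost_concat_map_t:
  "snd (concat_map_t f xs) = (\<Sum>x\<leftarrow>xs. snd (f x) + length (fst (f x)) + 2) + 1"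
  by (induction xs) (auto simp: split_def Let_def cost_append_t)

text \<open>The minimum allows a comparison to be charged to one side only, whatever the length of
  the stored fact or key on the other.\<close>

lemma cost_eq_list_t_le: "snd (eq_list_t xs ys) \<le> min (length xs) (length ys) + 1"
  by (induction xs ys rule: eq_list_t.induct) (auto simp: split_def Let_def)

lemma cost_member_t_le: "snd (member_t a As) \<le> length As * (length (args a) + 3) + 1"
proof -
  have "snd (eq_atom_t a b) \<le> length (args a) + 2" for b
    using cost_eq_list_t_le[of "args a" "args b"] by (simp add: eq_atom_t_def split_def Let_def)
  then have "snd (member_t a As) \<le> length As * (length (args a) + 2 + 1) + 1"
    unfolding member_t_def by (intro cost_ex_t_le)
  then show ?thesis by (simp add: numeral_3_eq_3)
qed

lemma cost_lookup_t_le: "snd (lookup_t \<sigma> x) \<le> length \<sigma> + 1"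
  by (induction \<sigma>) (auto simp: split_def Let_def)

lemma cost_eval_atom_t_le: "snd (eval_atom_t \<sigma> a) \<le> length (args a) * (length \<sigma> + 2) + 2"
proof -
  have "snd (eval_tm_t \<sigma> t) \<le> length \<sigma> + 1" for t
    using cost_lookup_t_le by (cases t) auto
  then have "snd (map_t (eval_tm_t \<sigma>) (args a)) \<le> length (args a) * (length \<sigma> + 1 + 1) + 1"
    by (intro cost_map_t_le)
  then show ?thesis by (simp add: eval_atom_t_def split_def Let_def)
qed

section \<open>Cost of testing one candidate assignment\<close>

lemma length_args_eval_atom_t: "length (args (fst (eval_atom_t \<sigma> a))) = length (args a)"
  by (cases a) simp

text \<open>Serves as a crude common bound for the arities of the atoms in the list.\<close>

definition total_args :: "('r, 't) atom list \<Rightarrow> nat" where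
  "total_args As = (\<Sum>a\<leftarrow>As. length (args a))"

lemma length_args_le_total_args: "a \<in> set As \<Longrightarrow> length (args a) \<le> total_args As"
  unfolding total_args_def by (intro member_le_sum_list) auto

lemma cost_body_holds_t_le:
  assumes "length I \<le> x" "length \<sigma> \<le> k"
  shows "snd (body_holds_t I \<xi> \<sigma>) \<le> length (body \<xi>) *
    (total_args (body \<xi>) * (k + 2) + 2 + (x * (total_args (body \<xi>) + 3) + 1) + 1 + 1) + 1"
  unfolding body_holds_t_def
proof (rule cost_all_t_le)
  fix a assume "a \<in> set (body \<xi>)"
  then have a: "length (args a) \<le> total_args (body \<xi>)" by (rule length_args_le_total_args)
  have "snd (eval_atom_t \<sigma> a) \<le> total_args (body \<xi>) * (k + 2) + 2"
    using a assms by (intro order_trans[OF cost_eval_atom_t_le] add_mono mult_mono) auto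
  moreover have "snd (member_t (fst (eval_atom_t \<sigma> a)) I) \<le> x * (total_args (body \<xi>) + 3) + 1"
    using a assms
    by (intro order_trans[OF cost_member_t_le] add_mono mult_mono)
       (auto simp: length_args_eval_atom_t simp del: fst_eval_atom_t)
  ultimately show "snd (let (f, c) = eval_atom_t \<sigma> a; (b, d) = member_t f I in (b, c + d + 1))
      \<le> total_args (body \<xi>) * (k + 2) + 2 + (x * (total_args (body \<xi>) + 3) + 1) + 1"
    by (simp add: split_def Let_def del: fst_eval_atom_t)
qed

lemma cost_frontier_values_t_le:
  assumes "length \<sigma> \<le> k"
  shows "snd (frontier_values_t \<xi> \<sigma>) \<le> length (frontier_list \<xi>) * (k + 2) + 1"
proof -
  have "snd (lookup_t \<sigma> x) \<le> k + 1" for x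
    using cost_lookup_t_le[of \<sigma> x] assms by simp
  then have "snd (frontier_values_t \<xi> \<sigma>) \<le> length (frontier_list \<xi>) * (k + 1 + 1) + 1"
    unfolding frontier_values_t_def by (intro cost_map_t_le)
  then show ?thesis by simp
qed

lemma cost_was_fired_t_le:
  assumes "length F \<le> x" "length \<sigma> \<le> k"
  shows "snd (was_fired_t F \<xi> \<sigma>) \<le>
    length (frontier_list \<xi>) * (k + 2) + 1 + (x * (length (frontier_list \<xi>) + 3) + 1) + 1"
proof -
  let ?ws = "fst (frontier_values_t \<xi> \<sigma>)"
  have len: "length ?ws = length (frontier_list \<xi>)" by (simp add: frontier_values_t_def)
  have "snd (ex_t (\<lambda>p. let (e, k) = eq_list_t (snd p) ?ws in (fst p = \<xi> \<and> e, k + 1)) F)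
      \<le> length F * (length (frontier_list \<xi>) + 2 + 1) + 1"
  proof (rule cost_ex_t_le)
    fix p
    show "snd (let (e, k) = eq_list_t (snd p) ?ws in (fst p = \<xi> \<and> e, k + 1))
        \<le> length (frontier_list \<xi>) + 2"
      using cost_eq_list_t_le[of "snd p" ?ws] len by (simp add: split_def Let_def)
  qed
  also have "\<dots> \<le> x * (length (frontier_list \<xi>) + 2 + 1) + 1"
    using assms(1) by (intro add_mono mult_mono) auto
  also have "\<dots> = x * (length (frontier_list \<xi>) + 3) + 1"
    by (simp add: numeral_3_eq_3)
  finally show ?thesis
    using cost_frontier_values_t_le[OF assms(2), of \<xi>]
    by (simp add: was_fired_t_def split_def Let_def)
qed

text \<open>In the search, \<open>xs\<close> lists the body variables of a fixed tgd, so the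
  exponent does not depend on the instance.\<close>

lemma length_assignments_t: "length (fst (assignments_t xs D)) = length D ^ length xs"
  by (induction xs) (auto simp: split_def Let_def length_concat comp_def sum_list_triv)

lemma length_assignment: "\<sigma> \<in> set (fst (assignments_t xs D)) \<Longrightarrow> length \<sigma> = length xs"
  by (induction xs arbitrary: \<sigma>) (auto simp: split_def Let_def)

text \<open>Follows \<open>cost_concat_map_t\<close>: for each of \<open>x\<close> values, a pass
  over \<open>x ^ k\<close> shorter assignments is paid for, and then the appending of its
  result.\<close>

primrec assignments_bound :: "nat \<Rightarrow> nat \<Rightarrow> nat" where
  "assignments_bound 0 x = 1"
| "assignments_bound (Suc k) x = assignments_bound k x + (x * (x ^ k * 2 + 1 + x ^ k + 2) + 1) + 1"

lemma poly_bounded_assignments_bound: "poly_bounded (assignments_bound k)"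
  by (induction k) (auto intro!: poly_bounded_intros)

lemma cost_assignments_t_le:
  assumes "length D \<le> x"
  shows "snd (assignments_t xs D) \<le> assignments_bound (length xs) x"
proof (induction xs)
  case Nil
  then show ?case by simp
next
  case (Cons y ys)
  let ?As = "fst (assignments_t ys D)"
  let ?f = "\<lambda>v. map_t (\<lambda>A. ((y, v) # A, 1::nat)) ?As"
  have len: "length ?As \<le> x ^ length ys"
    unfolding length_assignments_t using assms by (intro power_mono) auto
  have f: "snd (?f v) + length (fst (?f v)) + 2 \<le> x ^ length ys * 2 + 1 + x ^ length ys + 2" for v
  proof -
    have "snd (?f v) \<le> length ?As * (1 + 1) + 1" by (intro cost_map_t_le) simp
    then show ?thesis using len by simp
  qed
  have "snd (concat_map_t ?f D) \<le> (\<Sum>v\<leftarrow>D. x ^ length ys * 2 + 1 + x ^ length ys + 2) + 1"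
    unfolding cost_concat_map_t by (intro add_mono sum_list_mono f order_refl)
  also have "\<dots> \<le> x * (x ^ length ys * 2 + 1 + x ^ length ys + 2) + 1"
    unfolding sum_list_triv using assms by (intro add_mono mult_mono) auto
  finally show ?case
    using Cons.IH by (simp add: split_def Let_def)
qed

text \<open>The counterpart of \<open>inst_size\<close> for lists; the two agree on lists without
  repetitions.\<close>

definition state_size :: "('r, 't) atom list \<Rightarrow> nat" where
  "state_size As = (\<Sum>a\<leftarrow>As. 1 + length (args a))"

lemma length_le_state_size: "length As \<le> state_size As"
  by (induction As) (auto simp: state_size_def)

lemma length_concat_args_le: "length (concat (map args As)) \<le> state_size As"
  by (induction As) (auto simp: state_size_def)

section \<open>Cost of the search for triggers\<close>

definition filter_bound :: "'r tgd \<Rightarrow> nat \<Rightarrow> nat" where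
  "filter_bound \<xi> x = (let k = length (var_list (body \<xi>)); m = total_args (body \<xi>);
      l = length (frontier_list \<xi>)
    in length (body \<xi>) * (m * (k + 2) + 2 + (x * (m + 3) + 1) + 1 + 1) + 1
       + (l * (k + 2) + 1 + (x * (l + 3) + 1) + 1) + 1)"

definition search_tgd_bound :: "'r tgd \<Rightarrow> nat \<Rightarrow> nat" where
  "search_tgd_bound \<xi> x = (let k = length (var_list (body \<xi>))
    in 4 * x + 1 + assignments_bound k x + (x ^ k * (filter_bound \<xi> x + 1) + 1) +
       (x ^ k * 2 + 1) + 1)"

lemma poly_bounded_search_tgd_bound: "poly_bounded (search_tgd_bound \<xi>)"
  unfolding search_tgd_bound_def filter_bound_def Let_def
  by (intro poly_bounded_intros poly_bounded_assignments_bound)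

lemma search_tgd_t_le:
  assumes I: "state_size I \<le> x" and F: "length F \<le> x"
  shows "length (fst (search_tgd_t I F \<xi>)) \<le> x ^ length (var_list (body \<xi>))"
    and "snd (search_tgd_t I F \<xi>) \<le> search_tgd_bound \<xi> x"
proof -
  define k where "k = length (var_list (body \<xi>))"
  define D where "D = concat (map args I)"
  define As where "As = fst (assignments_t (var_list (body \<xi>)) D)"
  define P where "P = (\<lambda>\<sigma>. let (b, c) = body_holds_t I \<xi> \<sigma>; (f, d) = was_fired_t F \<xi> \<sigma>
                                   in (b \<and> \<not> f, c + d + 1))"
  define Bs where "Bs = fst (filter_t P As)"
  have D: "length D \<le> x" using length_concat_args_le[of I] I by (simp add: D_def)
  have As: "length As \<le> x ^ k"
    unfolding As_def length_assignments_t k_def using D by (intro power_mono) auto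
  have Bs: "length Bs \<le> x ^ k"
    unfolding Bs_def fst_filter_t by (rule order_trans[OF length_filter_le As])
  have split: "search_tgd_t I F \<xi> = (fst (map_t (\<lambda>\<sigma>. ((\<xi>, \<sigma>), 1::nat)) Bs),
      snd (concat_map_t (\<lambda>a. (args a, 1)) I) + snd (assignments_t (var_list (body \<xi>)) D) +
      snd (filter_t P As) + snd (map_t (\<lambda>\<sigma>. ((\<xi>, \<sigma>), 1::nat)) Bs) + 1)"
    by (simp add: search_tgd_t_def split_def Let_def D_def As_def Bs_def P_def)
  show "length (fst (search_tgd_t I F \<xi>)) \<le> x ^ length (var_list (body \<xi>))"
    unfolding split using Bs by (simp add: k_def)
  \<comment> \<open>A fact \<open>a\<close> costs \<open>length (args a) + 3\<close>, at most three
    times its share of \<open>state_size\<close>.\<close>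
  have "snd (concat_map_t (\<lambda>a. (args a, 1)) I) \<le> 3 * state_size I + 1"
    unfolding cost_concat_map_t by (induction I) (auto simp: state_size_def)
  also have "\<dots> \<le> 4 * x + 1" using I by simp
  finally have c1: "snd (concat_map_t (\<lambda>a. (args a, 1)) I) \<le> 4 * x + 1" .
  have c2: "snd (assignments_t (var_list (body \<xi>)) D) \<le> assignments_bound k x"
    unfolding k_def by (rule cost_assignments_t_le[OF D])
  have "snd (filter_t P As) \<le> length As * (filter_bound \<xi> x + 1) + 1"
  proof (rule cost_filter_t_le)
    fix \<sigma> assume "\<sigma> \<in> set As"
    then have \<sigma>: "length \<sigma> \<le> k" unfolding As_def k_def by (simp add: length_assignment)
    have "length I \<le> x" using I length_le_state_size[of I] by simp
    then show "snd (P \<sigma>) \<le> filter_bound \<xi> x"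
      using cost_body_holds_t_le[OF _ \<sigma>, of I x \<xi>] cost_was_fired_t_le[OF F \<sigma>, of \<xi>]
      unfolding P_def filter_bound_def k_def Let_def by (simp add: split_def)
  qed
  also have "\<dots> \<le> x ^ k * (filter_bound \<xi> x + 1) + 1"
    using As by (intro add_mono mult_mono) auto
  finally have c3: "snd (filter_t P As) \<le> x ^ k * (filter_bound \<xi> x + 1) + 1" .
  have "snd (map_t (\<lambda>\<sigma>. ((\<xi>, \<sigma>), 1::nat)) Bs) \<le> length Bs * (1 + 1) + 1"
    by (intro cost_map_t_le) simp
  with Bs have c4: "snd (map_t (\<lambda>\<sigma>. ((\<xi>, \<sigma>), 1::nat)) Bs) \<le> x ^ k * 2 + 1" by simp
  show "snd (search_tgd_t I F \<xi>) \<le> search_tgd_bound \<xi> x"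
    unfolding split search_tgd_bound_def Let_def k_def[symmetric] snd_conv
    by (intro add_mono c1 c2 c3 c4 order_refl)
qed

definition search_bound :: "'r tgd list \<Rightarrow> nat \<Rightarrow> nat" where
  "search_bound \<Sigma>s x =
     (\<Sum>\<xi>\<leftarrow>\<Sigma>s. search_tgd_bound \<xi> x + x ^ length (var_list (body \<xi>)) + 2) + 1"

lemma poly_bounded_search_bound: "poly_bounded (search_bound \<Sigma>s)"
  unfolding search_bound_def by (intro poly_bounded_intros poly_bounded_search_tgd_bound)

lemma search_t_le:
  assumes "state_size I \<le> x" "length F \<le> x"
  shows "snd (search_t \<Sigma>s I F) \<le> search_bound \<Sigma>s x"
    and "length (fst (search_t \<Sigma>s I F)) \<le> search_bound \<Sigma>s x"
proof -
  show cost: "snd (search_t \<Sigma>s I F) \<le> search_bound \<Sigma>s x"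
    unfolding search_t_def search_bound_def cost_concat_map_t
    by (intro add_mono sum_list_mono search_tgd_t_le[OF assms] order_refl)
  \<comment> \<open>Appending charges for every element of the result. The length itself matters
    because each step pays it for picking a trigger.\<close>
  have "length (fst (concat_map_t f xs)) \<le> snd (concat_map_t f xs)" for f :: "'c \<Rightarrow> 'd list timed" and xs
    unfolding cost_concat_map_t fst_concat_map_t by (induction xs) (auto simp del: concat_map_t.simps)
  then show "length (fst (search_t \<Sigma>s I F)) \<le> search_bound \<Sigma>s x"
    using cost order_trans unfolding search_t_def by blast
qed

section \<open>Cost of firing a trigger\<close>

lemma state_size_insert_all_t: "state_size (fst (insert_all_t As I)) \<le> state_size As + state_size I"
  by (induction As) (auto simp: split_def Let_def state_size_def)

lemma cost_insert_all_t_le: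
  "snd (insert_all_t As I) \<le> length As * ((length As + length I) * (total_args As + 3) + 2) + 1"
proof -
  have len: "length (fst (insert_all_t As I)) \<le> length As + length I" for As
    by (induction As) (auto simp: split_def Let_def)
  \<comment> \<open>The bounds \<open>m\<close> and \<open>n\<close> are kept fixed through the
    induction; \<open>total_args As\<close> and \<open>length As\<close> would shrink with the
    list.\<close>
  have "snd (insert_all_t As I) \<le> length As * ((n + length I) * (m + 3) + 2) + 1"
    if "\<forall>a\<in>set As. length (args a) \<le> m" "length As \<le> n" for n m
    using that
  proof (induction As)
    case Nil
    then show ?case by simp
  next
    case (Cons a As)
    have "snd (member_t a (fst (insert_all_t As I))) \<le> (n + length I) * (m + 3) + 1"
      using Cons.prems len[of As]
      by (intro order_trans[OF cost_member_t_le] add_mono mult_mono) auto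
    then show ?case using Cons by (simp add: split_def Let_def)
  qed
  then show ?thesis using length_args_le_total_args by blast
qed

definition fire_bound :: "'r tgd \<Rightarrow> nat \<Rightarrow> nat" where
  "fire_bound \<xi> x = (let k = length (var_list (body \<xi> @ head \<xi>)); l = length (head \<xi>);
      m = total_args (head \<xi>)
    in k * 2 + 1 + (l * (m * (k + 2) + 2 + 1) + 1) + (l * ((l + x) * (m + 3) + 2) + 1) +
       (length (frontier_list \<xi>) * (k + 2) + 1) + 1)"

lemma poly_bounded_fire_bound: "poly_bounded (fire_bound \<xi>)"
  unfolding fire_bound_def Let_def by (intro poly_bounded_intros)

lemma fire_t_le:
  assumes I: "state_size I \<le> x"
  shows "snd (fire_t I F \<xi> g) \<le> fire_bound \<xi> x"
    and "state_size (fst (fst (fire_t I F \<xi> g))) \<le> state_size I + state_size (head \<xi>)"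
proof -
  define xs where "xs = var_list (body \<xi> @ head \<xi>)"
  define \<sigma> where "\<sigma> = fst (map_t (\<lambda>x. ((x, g x), 1::nat)) xs)"
  define As where "As = fst (map_t (eval_atom_t \<sigma>) (head \<xi>))"
  have split: "snd (fire_t I F \<xi> g) =
      snd (map_t (\<lambda>x. ((x, g x), 1::nat)) xs) + snd (map_t (eval_atom_t \<sigma>) (head \<xi>)) +
      snd (insert_all_t As I) + snd (frontier_values_t \<xi> \<sigma>) + 1"
    "fst (fst (fire_t I F \<xi> g)) = fst (insert_all_t As I)"
    by (simp_all add: fire_t_def split_def Let_def xs_def \<sigma>_def As_def)
  have \<sigma>: "length \<sigma> \<le> length xs" by (simp add: \<sigma>_def)
  have As: "length As = length (head \<xi>)" "total_args As = total_args (head \<xi>)"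
      "state_size As = state_size (head \<xi>)"
    by (simp_all add: As_def total_args_def state_size_def comp_def length_args_eval_atom_t
        del: fst_eval_atom_t)
  show "state_size (fst (fst (fire_t I F \<xi> g))) \<le> state_size I + state_size (head \<xi>)"
    unfolding split using state_size_insert_all_t[of As I] As by simp
  have c1: "snd (map_t (\<lambda>x. ((x, g x), 1::nat)) xs) \<le> length xs * 2 + 1"
    using cost_map_t_le[of xs "\<lambda>x. ((x, g x), 1::nat)" 1] by simp
  have c2: "snd (map_t (eval_atom_t \<sigma>) (head \<xi>)) \<le>
      length (head \<xi>) * (total_args (head \<xi>) * (length xs + 2) + 2 + 1) + 1"
    using \<sigma> length_args_le_total_args
    by (intro cost_map_t_le order_trans[OF cost_eval_atom_t_le] add_mono mult_mono) auto
  have c3: "snd (insert_all_t As I) \<le>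
      length (head \<xi>) * ((length (head \<xi>) + x) * (total_args (head \<xi>) + 3) + 2) + 1"
    using I length_le_state_size[of I]
    by (intro order_trans[OF cost_insert_all_t_le] add_mono mult_mono) (auto simp: As)
  have c4: "snd (frontier_values_t \<xi> \<sigma>) \<le> length (frontier_list \<xi>) * (length xs + 2) + 1"
    by (rule cost_frontier_values_t_le[OF \<sigma>])
  show "snd (fire_t I F \<xi> g) \<le> fire_bound \<xi> x"
    unfolding split fire_bound_def Let_def xs_def[symmetric]
    by (intro add_mono c1 c2 c3 c4 order_refl)
qed

section \<open>Cost of a whole run\<close>

definition growth :: "'r tgd list \<Rightarrow> nat" where
  "growth \<Sigma>s = (\<Sum>\<xi>\<leftarrow>\<Sigma>s. state_size (head \<xi>)) + 1"

text \<open>The search bound counts twice: for the cost of the search and for the number of triggers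
  found.\<close>

definition step_cost_bound :: "'r tgd list \<Rightarrow> nat \<Rightarrow> nat" where
  "step_cost_bound \<Sigma>s x = 2 * search_bound \<Sigma>s x + (\<Sum>\<xi>\<leftarrow>\<Sigma>s. fire_bound \<xi> x) + 1"

lemma poly_bounded_step_cost_bound: "poly_bounded (step_cost_bound \<Sigma>s)"
  unfolding step_cost_bound_def
  by (intro poly_bounded_intros poly_bounded_search_bound poly_bounded_fire_bound)

text \<open>A single \<open>x\<close> bounds both the facts and the fired list throughout the run,
  so each step costs at most \<open>step_cost_bound \<Sigma>s x\<close>.\<close>

lemma run_t_le:
  assumes "\<And>i. i < n \<Longrightarrow> fst (T i) \<in> set \<Sigma>s"
    and "state_size Is + n * growth \<Sigma>s \<le> x"
  shows "state_size (fst (fst (run_t \<Sigma>s Is T H n))) \<le> state_size Is + n * growth \<Sigma>s \<and>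
    length (snd (fst (run_t \<Sigma>s Is T H n))) = n \<and>
    snd (run_t \<Sigma>s Is T H n) \<le> n * step_cost_bound \<Sigma>s x + 1"
  using assms
proof (induction n)
  case 0
  then show ?case by simp
next
  case (Suc n)
  let ?I = "fst (fst (run_t \<Sigma>s Is T H n))" and ?F = "snd (fst (run_t \<Sigma>s Is T H n))"
  let ?\<xi> = "fst (T n)"
  have IH: "state_size ?I \<le> state_size Is + n * growth \<Sigma>s" "length ?F = n"
    "snd (run_t \<Sigma>s Is T H n) \<le> n * step_cost_bound \<Sigma>s x + 1"
    using Suc by auto
  have I: "state_size ?I \<le> x" using IH(1) Suc.prems(2) by simp
  \<comment> \<open>The summand 1 in \<open>growth\<close> gives this, so \<open>x\<close> also
    bounds the length of the list of fired classes.\<close>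
  have grow: "n \<le> n * growth \<Sigma>s" by (simp add: growth_def)
  have F: "length ?F \<le> x"
    using grow IH(2) Suc.prems(2) unfolding mult_Suc by linarith
  have \<xi>: "?\<xi> \<in> set \<Sigma>s" using Suc.prems(1) by simp
  have "state_size (head ?\<xi>) \<le> (\<Sum>\<xi>\<leftarrow>\<Sigma>s. state_size (head \<xi>))"
    using \<xi> by (intro member_le_sum_list) auto
  then have 1: "state_size (fst (fst (fire_t ?I ?F ?\<xi> (H n)))) \<le> state_size Is + Suc n * growth \<Sigma>s"
    using fire_t_le(2)[OF I, of ?F ?\<xi> "H n"] IH(1) by (simp add: growth_def)
  have "fire_bound ?\<xi> x \<le> (\<Sum>\<xi>\<leftarrow>\<Sigma>s. fire_bound \<xi> x)"
    using \<xi> by (intro member_le_sum_list) auto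
  then have "snd (search_t \<Sigma>s ?I ?F) + length (fst (search_t \<Sigma>s ?I ?F)) +
      snd (fire_t ?I ?F ?\<xi> (H n)) + 1 \<le> step_cost_bound \<Sigma>s x"
    using search_t_le[OF I F, of \<Sigma>s] fire_t_le(1)[OF I, of ?F ?\<xi> "H n"]
    by (simp add: step_cost_bound_def)
  with IH(3) have "snd (run_t \<Sigma>s Is T H (Suc n)) \<le> Suc n * step_cost_bound \<Sigma>s x + 1"
    by (simp add: split_def Let_def)
  moreover have "fst (run_t \<Sigma>s Is T H (Suc n)) = fst (fire_t ?I ?F ?\<xi> (H n))"
    by (simp add: split_def Let_def)
  ultimately show ?case using 1 IH(2) by (simp add: fire_t_correct(2) del: run_t.simps)
qed

lemma chase_time_le:
  assumes "\<And>i. i < n \<Longrightarrow> fst (T i) \<in> set \<Sigma>s"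
    and "state_size Is + n * growth \<Sigma>s \<le> x"
  shows "chase_time \<Sigma>s Is T H n \<le> n * step_cost_bound \<Sigma>s x + 1 + search_bound \<Sigma>s x"
proof -
  have run: "state_size (fst (fst (run_t \<Sigma>s Is T H n))) \<le> state_size Is + n * growth \<Sigma>s"
    "length (snd (fst (run_t \<Sigma>s Is T H n))) = n"
    "snd (run_t \<Sigma>s Is T H n) \<le> n * step_cost_bound \<Sigma>s x + 1"
    using run_t_le[of n T \<Sigma>s Is x H] assms by blast+
  have grow: "n \<le> n * growth \<Sigma>s" by (simp add: growth_def)
  have "snd (search_t \<Sigma>s (fst (fst (run_t \<Sigma>s Is T H n))) (snd (fst (run_t \<Sigma>s Is T H n))))
      \<le> search_bound \<Sigma>s x"
    using grow run(1,2) assms(2) by (intro search_t_le(1)) linarith+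
  with run(3) show ?thesis by (simp add: chase_time_def split_def Let_def)
qed

section \<open>Polynomial running time and termination\<close>

lemma SD_polynomial:
  assumes "set \<Sigma>s \<in> SD ar"
  shows "\<exists>p :: nat poly. \<forall>I Is N S T H.
    is_instance ar I \<and> set Is = I \<and> distinct Is \<and> chase_sequence (set \<Sigma>s) I N S T H \<longrightarrow>
    (\<exists>n. terminates_at (set \<Sigma>s) N S T n \<and>
         n \<le> poly p (inst_size I) \<and> chase_time \<Sigma>s Is T H n \<le> poly p (inst_size I))"
proof -
  let ?s = "step_bound (set \<Sigma>s)"
  \<comment> \<open>Bounds the state after at most \<open>?s b\<close> steps from an instance of
    size \<open>b\<close>.\<close>
  let ?x = "\<lambda>b. b + ?s b * growth \<Sigma>s"
  \<comment> \<open>Steps and time are added so that one polynomial serves for both.\<close>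
  let ?b = "\<lambda>b. ?s b + (?s b * step_cost_bound \<Sigma>s (?x b) + 1 + search_bound \<Sigma>s (?x b))"
  have "poly_bounded ?b"
    by (intro poly_bounded_intros poly_bounded_step_bound
        poly_bounded_compose[OF poly_bounded_step_cost_bound]
        poly_bounded_compose[OF poly_bounded_search_bound])
  then obtain p where p: "\<And>b. ?b b \<le> poly p b" unfolding poly_bounded_def by blast
  have "\<exists>n. terminates_at (set \<Sigma>s) N S T n \<and> n \<le> poly p (inst_size I) \<and>
      chase_time \<Sigma>s Is T H n \<le> poly p (inst_size I)"
    if I: "is_instance ar I" "set Is = I" "distinct Is"
      and seq: "chase_sequence (set \<Sigma>s) I N S T H" for I Is N S T H
  proof -
    interpret chase "set \<Sigma>s" I N S T H
      by unfold_locales (use I seq in \<open>auto simp: is_instance_def\<close>)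
    obtain n where n: "N = enat n" "terminates_at (set \<Sigma>s) N S T n" "n \<le> ?s (inst_size I)"
      using safe_terminates assms unfolding SD_def by blast
    \<comment> \<open>The list has no repetitions, so its sum is the sum over the instance.\<close>
    have size: "state_size Is = inst_size I"
      unfolding state_size_def inst_size_def I(2)[symmetric]
      by (rule sum_list_distinct_conv_sum_set[OF I(3)])
    have "chase_time \<Sigma>s Is T H n \<le> n * step_cost_bound \<Sigma>s (?x (inst_size I)) + 1 +
        search_bound \<Sigma>s (?x (inst_size I))"
    proof (rule chase_time_le)
      show "fst (T i) \<in> set \<Sigma>s" if "i < n" for i using step(1) that n(1) by simp
      show "state_size Is + n * growth \<Sigma>s \<le> ?x (inst_size I)"
        unfolding size using n(3) by simp
    qed
    also have "\<dots> \<le> ?b (inst_size I)"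
      using mult_le_mono1[OF n(3), of "step_cost_bound \<Sigma>s (?x (inst_size I))"] by linarith
    also have "\<dots> \<le> poly p (inst_size I)" by (rule p)
    finally have "chase_time \<Sigma>s Is T H n \<le> poly p (inst_size I)" .
    moreover have "n \<le> poly p (inst_size I)" using n(3) p[of "inst_size I"] by simp
    ultimately show ?thesis using n(2) by blast
  qed
  then show ?thesis by blast
qed

lemma SD_subset_CT_sobl: "SD ar \<subseteq> CT_sobl ar"
proof
  fix \<Sigma> assume \<Sigma>: "\<Sigma> \<in> SD ar"
  have "\<exists>n. terminates_at \<Sigma> N S T n"
    if "is_instance ar I" "chase_sequence \<Sigma> I N S T H" for I N S T H
  proof -
    interpret chase \<Sigma> I N S T H
      by unfold_locales (use \<Sigma> that in \<open>auto simp: SD_def tgd_set_def is_instance_def\<close>)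
    show ?thesis using safe_terminates \<Sigma> unfolding SD_def by blast
  qed
  then show "\<Sigma> \<in> CT_sobl ar" using \<Sigma> unfolding CT_sobl_def SD_def by blast
qed

theorem proposition8:
  fixes ar :: "'r \<Rightarrow> nat"
  shows "WA ar \<subseteq> CT_sobl ar \<and> SD ar \<subseteq> CT_sobl ar \<and>
    (\<forall>\<Sigma>s. distinct \<Sigma>s \<and> set \<Sigma>s \<in> SD ar \<longrightarrow>
      (\<exists>p :: nat poly. \<forall>I Is N S T H.
        is_instance ar I \<and> set Is = I \<and> distinct Is \<and> chase_sequence (set \<Sigma>s) I N S T H \<longrightarrow>
        (\<exists>n. terminates_at (set \<Sigma>s) N S T n \<and>
             n \<le> poly p (inst_size I) \<and>
             chase_time \<Sigma>s Is T H n \<le> poly p (inst_size I))))"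
  using WA_subset_SD SD_subset_CT_sobl SD_polynomial by blast

end
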